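(* Let $p=p(n)\in[0,1]$ and let $\lambda(n,p)=(n+1)!\,(1-p)^n$. Let $\operatorname{Perm}(n)_p$ denote the random subgraph of the $n$-dimensional permutahedron obtained by keeping each edge independently with probability $p$. Then \[\lim_{n\to\infty}\mathbb{P}(\operatorname{Perm}(n)_p\text{ is connected})=\begin{cases}0&\text{if }\lambda(n,p)\to\infty;\\ e^{-c}&\text{if }\lambda(n,p)\to c\ge 0.\end{cases}\]
   Context: The $n$-dimensional permutahedron $\operatorname{Perm}(n)$ is the graph with vertex set the symmetric group $S_{n+1}$ and edge set $\{\{\pi,\tau_i\pi\}:\pi\in S_{n+1},\,1\le i\le n\}$, where $\tau_i$ is the transposition $(i,i+1)$ and $(\sigma\pi)(j)=\sigma(\pi(j))$. *)

theory Defs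
  imports "HOL-Probability.Probability" "HOL-Combinatorics.Permutations"
    "Graph_Theory.Digraph_Component"
begin

definition permutahedron_verts :: "nat \<Rightarrow> (nat \<Rightarrow> nat) set" where
  "permutahedron_verts n = {\<pi>. \<pi> permutes {1..n + 1}}"

definition permutahedron_edges :: "nat \<Rightarrow> (nat \<Rightarrow> nat) set set" where
  "permutahedron_edges n =
     {{\<pi>, Transposition.transpose i (i + 1) \<circ> \<pi>} | \<pi> i.
        \<pi> \<in> permutahedron_verts n \<and> i \<in> {1..n}}"

text \<open>Every undirected edge \<open>{u, v}\<close> is represented by the two arcs \<open>(u, v)\<close> and \<open>(v, u)\<close>.\<close>

definition undirected_graph :: "'a set \<Rightarrow> 'a set set \<Rightarrow> 'a pair_pre_digraph" where
  "undirected_graph V E = \<lparr>pverts = V, parcs = {(u, v). {u, v} \<in> E}\<rparr>"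

definition permutahedron :: "nat \<Rightarrow> (nat \<Rightarrow> nat) pair_pre_digraph" where
  "permutahedron n = undirected_graph (permutahedron_verts n) (permutahedron_edges n)"

text \<open>
  The coin flips are indexed by the undirected edges, so the two arcs of an edge are kept or
  deleted together. All vertices are kept.
\<close>

definition random_permutahedron ::
    "nat \<Rightarrow> real \<Rightarrow> (nat \<Rightarrow> nat) pair_pre_digraph pmf" where
  "random_permutahedron n p =
     map_pmf (\<lambda>keep. undirected_graph (permutahedron_verts n) {e \<in> permutahedron_edges n. keep e})
       (Pi_pmf (permutahedron_edges n) False (\<lambda>_. bernoulli_pmf p))"

definition permutahedron_lambda :: "nat \<Rightarrow> real \<Rightarrow> real" where
  "permutahedron_lambda n p = fact (n + 1) * (1 - p) ^ n"

text \<open>\<^const>\<open>Pi_pmf\<close> is the product distribution only for finite index sets.\<close>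

lemma finite_permutahedron_verts: "finite (permutahedron_verts n)"
  by (simp add: permutahedron_verts_def finite_permutations)

lemma finite_permutahedron_edges: "finite (permutahedron_edges n)"
proof -
  have "permutahedron_edges n \<subseteq>
      (\<lambda>(\<pi>, i). {\<pi>, Transposition.transpose i (i + 1) \<circ> \<pi>}) ` (permutahedron_verts n \<times> {1..n})"
    unfolding permutahedron_edges_def by auto
  then show ?thesis
    by (rule finite_subset) (simp add: finite_permutahedron_verts)
qed

text \<open>The permutahedron is a simple graph, and deleting no edge gives it back.\<close>

lemma permutahedron_edge:
  assumes "e \<in> permutahedron_edges n"
  shows "e \<subseteq> permutahedron_verts n" "card e = 2"
proof -
  obtain \<pi> i where e: "e = {\<pi>, Transposition.transpose i (i + 1) \<circ> \<pi>}"
    and \<pi>: "\<pi> permutes {1..n + 1}" and i: "1 \<le> i" "i \<le> n"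
    using assms by (auto simp: permutahedron_edges_def permutahedron_verts_def)
  have "Transposition.transpose i (i + 1) permutes {1..n + 1}"
    using i by (intro permutes_swap_id) auto
  then show "e \<subseteq> permutahedron_verts n"
    using \<pi> by (auto simp: e permutahedron_verts_def intro: permutes_compose)
  obtain x where "\<pi> x = i"
    using permutes_surj[OF \<pi>] by (metis surjD)
  then have "(Transposition.transpose i (i + 1) \<circ> \<pi>) x \<noteq> \<pi> x"
    by simp
  then have "\<pi> \<noteq> Transposition.transpose i (i + 1) \<circ> \<pi>"
    by metis
  then show "card e = 2"
    by (simp add: e)
qed

lemma random_permutahedron_1: "random_permutahedron n 1 = return_pmf (permutahedron n)"
proof -
  have "bernoulli_pmf 1 = return_pmf True"
    by (rule pmf_eqI) (auto simp: pmf_return indicator_def split: bool.splits)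
  moreover have "{e \<in> permutahedron_edges n. e \<in> permutahedron_edges n} = permutahedron_edges n"
    by blast
  ultimately show ?thesis
    by (simp add: random_permutahedron_def permutahedron_def finite_permutahedron_edges cong: conj_cong)
qed

end

theory Submission
  imports Defs "HOL-Real_Asymp.Real_Asymp"
begin

text \<open>
  Write \<open>q = 1 - p\<close>. If \<open>\<lambda> \<rightarrow> \<infinity>\<close>, look only at permutations of one parity: no two of them are
  adjacent, so they are isolated independently of each other, and the probability that none of
  them is isolated is at most \<open>exp (- \<lambda> / 2)\<close>.

  Let \<open>\<lambda> \<rightarrow> c\<close>, so that \<open>q \<rightarrow> 0\<close>. Revealing the vertices one at a time, being isolated is
  independent of what happens away from the neighbours, whence
  \<open>\<bar>P(no isolated vertex) - (1 - q^n)^(n+1)!\<bar> \<le> (n+1)! n q^(2n-1)\<close>, and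
  \<open>(1 - q^n)^(n+1)!\<close> tends to \<open>exp (- c)\<close>.

  It remains to see that isolated vertices are the only obstruction. Call a vertex poor if more than
  three quarters of its edges are deleted. With high probability no two adjacent vertices are poor,
  and two vertices \<open>\<tau>\<^sub>a x\<close>, \<open>\<tau>\<^sub>b x\<close> that are not poor are always linked: commutation of distant
  adjacent transpositions gives quadratically many short walks between them, and deleting that many
  edges locally is too unlikely for \<open>(n+1)!\<close> vertices to matter. A poor vertex \<open>u\<close> that is not
  isolated has a kept edge to some \<open>\<tau>\<^sub>a u\<close>, which is linked to every other neighbour of \<open>u\<close>. So all
  edges of the permutahedron join linked vertices.
\<close>

section \<open>Adjacent transpositions and the edges of the permutahedron\<close>

text \<open>With the convention that index \<open>0\<close> gives the identity, a path that stays put at some step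
  needs no separate treatment; \<open>perm_edge \<pi> 0\<close> is a singleton and hence never an edge.\<close>

definition adj_swap :: "nat \<Rightarrow> nat \<Rightarrow> nat" where
  "adj_swap i = (if i = 0 then id else Transposition.transpose i (i + 1))"

definition perm_edge :: "(nat \<Rightarrow> nat) \<Rightarrow> nat \<Rightarrow> (nat \<Rightarrow> nat) set" where
  "perm_edge \<pi> i = {\<pi>, adj_swap i \<circ> \<pi>}"

lemma adj_swap_0 [simp]: "adj_swap 0 = id"
  by (simp add: adj_swap_def)

lemma adj_swap_adj_swap [simp]: "adj_swap i (adj_swap i x) = x"
  by (simp add: adj_swap_def)

lemma adj_swap_comp_adj_swap [simp]: "adj_swap i \<circ> (adj_swap i \<circ> \<pi>) = \<pi>"
  by (simp add: fun_eq_iff)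

lemma adj_swap_commute:
  assumes "i \<notin> {k - 1, k, k + 1}"
  shows "adj_swap i (adj_swap k x) = adj_swap k (adj_swap i x)"
  using assms unfolding adj_swap_def Transposition.transpose_def by auto

lemma permutes_adj_swap: "i \<le> n \<Longrightarrow> adj_swap i permutes {1..n + 1}"
  by (auto simp: adj_swap_def permutes_id intro!: permutes_swap_id)

lemma adj_swap_comp_in_verts:
  "\<pi> \<in> permutahedron_verts n \<Longrightarrow> i \<le> n \<Longrightarrow> adj_swap i \<circ> \<pi> \<in> permutahedron_verts n"
  unfolding permutahedron_verts_def using permutes_adj_swap by (auto intro: permutes_compose)

lemma permutation_if_in_verts: "\<pi> \<in> permutahedron_verts n \<Longrightarrow> permutation \<pi>"
  unfolding permutahedron_verts_def permutation_permutes by (auto intro!: exI[of _ "{1..n + 1}"])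

text \<open>Parity makes the permutahedron bipartite. This serves twice: vertices of one parity are
  never adjacent, and an edge can be oriented by naming the parity of its first end.\<close>

lemma evenperm_adj_swap_comp:
  assumes "\<pi> \<in> permutahedron_verts n" "i \<noteq> 0"
  shows "evenperm (adj_swap i \<circ> \<pi>) \<longleftrightarrow> \<not> evenperm \<pi>"
  using permutation_if_in_verts[OF assms(1)] assms(2)
  by (auto simp: adj_swap_def evenperm_comp permutation_swap_id evenperm_swap)

lemma comp_verts_cancel:
  assumes "\<pi> \<in> permutahedron_verts n" "f \<circ> \<pi> = g \<circ> \<pi>"
  shows "f = g"
  using assms permutes_surj[of \<pi> "{1..n + 1}"]
  unfolding permutahedron_verts_def by (metis mem_Collect_eq surj_fun_eq)

lemma inj_adj_swap: "adj_swap i = adj_swap j \<Longrightarrow> i = j"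
proof -
  have "i \<le> j" if "adj_swap i = adj_swap j" for i j
  proof (rule ccontr)
    assume "\<not> i \<le> j"
    \<comment> \<open>For \<open>j > 0\<close> the two sides differ at \<open>j\<close>, which
      \<open>adj_swap i\<close> fixes; for \<open>j = 0\<close> the right side is the identity and
      they differ at \<open>i\<close>.\<close>
    with fun_cong[OF that, of j] fun_cong[OF that, of i] show False
      by (auto simp: adj_swap_def Transposition.transpose_def split: if_splits)
  qed
  then show "adj_swap i = adj_swap j \<Longrightarrow> i = j"
    by (metis antisym)
qed

text \<open>The smaller index is the least point moved by the product, so it can be read off;
  cancelling that factor then determines the larger index.\<close>

lemma adj_swap_pair_inj:
  assumes "i \<noteq> 0" "i + 2 \<le> k" "i' \<noteq> 0" "i' + 2 \<le> k'"
    and eq: "adj_swap k \<circ> adj_swap i = adj_swap k' \<circ> adj_swap i'"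
  shows "i = i' \<and> k = k'"
proof -
  have "i \<ge> i'" if "i \<noteq> 0" "i + 2 \<le> k" "i' \<noteq> 0" "i' + 2 \<le> k'"
    and eq: "adj_swap k \<circ> adj_swap i = adj_swap k' \<circ> adj_swap i'" for i i' k k'
    using fun_cong[OF eq, of i] that(1-4)
    by (auto simp: adj_swap_def Transposition.transpose_def split: if_splits)
  from this[OF assms] this[OF assms(3,4,1,2) eq[symmetric]] have i: "i = i'"
    by simp
  have "adj_swap k x = adj_swap k' x" for x
    using fun_cong[OF eq, of "adj_swap i x"] i by simp
  then show ?thesis
    using i inj_adj_swap by blast
qed

lemma permutahedron_edges_iff:
  "e \<in> permutahedron_edges n \<longleftrightarrow> (\<exists>\<pi>\<in>permutahedron_verts n. \<exists>i\<in>{1..n}. e = perm_edge \<pi> i)"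
proof -
  have "perm_edge \<pi> i = {\<pi>, Transposition.transpose i (i + 1) \<circ> \<pi>}" if "i \<in> {1..n}" for \<pi> i
    using that by (simp add: perm_edge_def adj_swap_def)
  then show ?thesis
    unfolding permutahedron_edges_def mem_Collect_eq by metis
qed

lemma perm_edge_in_edges:
  "\<pi> \<in> permutahedron_verts n \<Longrightarrow> i \<in> {1..n} \<Longrightarrow> perm_edge \<pi> i \<in> permutahedron_edges n"
  using permutahedron_edges_iff by blast

lemma perm_edge_0_notin_edges: "perm_edge \<pi> 0 \<notin> permutahedron_edges n"
  using permutahedron_edge(2)[of "perm_edge \<pi> 0" n] by (auto simp: perm_edge_def)

lemma perm_edge_flip: "perm_edge (adj_swap i \<circ> \<pi>) i = perm_edge \<pi> i"
  by (auto simp: perm_edge_def)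

text \<open>An edge has exactly one end of each parity, so fixing the parity of the base vertex
  leaves only one way to write the edge.\<close>

lemma perm_edge_inj:
  assumes "\<pi> \<in> permutahedron_verts n" "\<pi>' \<in> permutahedron_verts n"
    and "evenperm \<pi> = evenperm \<pi>'" "i \<noteq> 0" "i' \<noteq> 0" "perm_edge \<pi> i = perm_edge \<pi>' i'"
  shows "\<pi> = \<pi>' \<and> i = i'"
proof -
  have "\<pi> \<noteq> adj_swap i' \<circ> \<pi>'"
    using evenperm_adj_swap_comp[OF assms(2,5)] assms(3) by auto
  then have eq: "\<pi> = \<pi>'" "adj_swap i \<circ> \<pi> = adj_swap i' \<circ> \<pi>'"
    using assms(6) by (auto simp: perm_edge_def doubleton_eq_iff)
  then show ?thesis
    using comp_verts_cancel[OF assms(1)] inj_adj_swap by blast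
qed

section \<open>Edges and neighbours of a vertex\<close>

definition vertex_star :: "nat \<Rightarrow> (nat \<Rightarrow> nat) \<Rightarrow> (nat \<Rightarrow> nat) set set" where
  "vertex_star n v = {e \<in> permutahedron_edges n. v \<in> e}"

lemma finite_vertex_star: "finite (vertex_star n v)"
  unfolding vertex_star_def using finite_permutahedron_edges by simp

lemma vertex_star_subset: "vertex_star n v \<subseteq> permutahedron_edges n"
  unfolding vertex_star_def by simp

lemma vertex_star_eq:
  assumes "v \<in> permutahedron_verts n"
  shows "vertex_star n v = perm_edge v ` {1..n}"
proof -
  have "e \<in> perm_edge v ` {1..n}" if e: "e \<in> vertex_star n v" for e
  proof -
    obtain \<pi> i where i: "i \<in> {1..n}" and "e = perm_edge \<pi> i" "v \<in> perm_edge \<pi> i"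
      using e unfolding vertex_star_def mem_Collect_eq permutahedron_edges_iff by blast
    \<comment> \<open>If \<open>v\<close> is the far end of the edge, \<open>perm_edge_flip\<close>
      re-bases the edge at \<open>v\<close> with the same index.\<close>
    then have "e = perm_edge v i"
      using perm_edge_flip[of i \<pi>] unfolding perm_edge_def by blast
    with i show ?thesis
      by blast
  qed
  then show ?thesis
    using perm_edge_in_edges[OF assms] by (auto simp: vertex_star_def perm_edge_def)
qed

lemma inj_on_perm_edge: "v \<in> permutahedron_verts n \<Longrightarrow> inj_on (perm_edge v) {1..n}"
  using perm_edge_inj[of v n v] by (auto intro!: inj_onI)

lemma card_vertex_star: "v \<in> permutahedron_verts n \<Longrightarrow> card (vertex_star n v) = n"
  using card_image[OF inj_on_perm_edge[of v n]] by (simp add: vertex_star_eq)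

lemma vertex_star_Int:
  assumes "v \<noteq> w"
  shows "vertex_star n v \<inter> vertex_star n w \<subseteq> {{v, w}}"
proof
  fix e assume "e \<in> vertex_star n v \<inter> vertex_star n w"
  then have "card e = 2" "v \<in> e" "w \<in> e"
    using permutahedron_edge(2) by (auto simp: vertex_star_def)
  then show "e \<in> {{v, w}}"
    using assms by (auto simp: card_2_iff)
qed

text \<open>Two stars share at most the edge joining their centres. This single shared edge is why
  the exponent \<open>2 * n - 1\<close> appears later.\<close>

lemma card_vertex_star_Un:
  assumes "v \<in> permutahedron_verts n" "w \<in> permutahedron_verts n" "v \<noteq> w"
  shows "card (vertex_star n v \<union> vertex_star n w) \<ge> 2 * n - 1"
  using card_Un_Int[OF finite_vertex_star finite_vertex_star, of n v n w]
    card_mono[OF _ vertex_star_Int[OF assms(3)], of n] card_vertex_star[OF assms(1)]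
    card_vertex_star[OF assms(2)]
  by simp

definition neighbours :: "nat \<Rightarrow> (nat \<Rightarrow> nat) \<Rightarrow> (nat \<Rightarrow> nat) set" where
  "neighbours n v = {w. {v, w} \<in> permutahedron_edges n}"

lemma neighbours_eq:
  assumes "v \<in> permutahedron_verts n"
  shows "neighbours n v = (\<lambda>i. adj_swap i \<circ> v) ` {1..n}"
proof -
  have "w \<in> (\<lambda>i. adj_swap i \<circ> v) ` {1..n}" if "{v, w} \<in> permutahedron_edges n" for w
  proof -
    have "{v, w} \<in> perm_edge v ` {1..n}"
      using that vertex_star_eq[OF assms] by (auto simp: vertex_star_def)
    then show ?thesis
      by (auto simp: perm_edge_def doubleton_eq_iff)
  qed
  then show ?thesis
    using perm_edge_in_edges[OF assms] by (auto simp: neighbours_def perm_edge_def)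
qed

lemma card_neighbours_le:
  assumes "v \<in> permutahedron_verts n"
  shows "finite (neighbours n v)" "card (neighbours n v) \<le> n"
proof -
  show "finite (neighbours n v)"
    by (simp add: neighbours_eq[OF assms])
  show "card (neighbours n v) \<le> n"
    using card_image_le[of "{1..n}" "\<lambda>i. adj_swap i \<circ> v"] by (simp add: neighbours_eq[OF assms])
qed

lemma neighbours_subset:
  "v \<in> permutahedron_verts n \<Longrightarrow> neighbours n v \<subseteq> permutahedron_verts n"
  using adj_swap_comp_in_verts by (auto simp: neighbours_eq)

text \<open>Disjoint stars depend on different coins, which is what makes the isolation of
  non-adjacent vertices independent.\<close>

lemma vertex_star_disjoint:
  assumes "v \<noteq> w" "w \<notin> neighbours n v"
  shows "vertex_star n v \<inter> vertex_star n w = {}"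
  using vertex_star_Int[OF assms(1), of n] assms(2) vertex_star_subset[of n v]
  by (auto simp: neighbours_def)

lemma neighbours_parity:
  assumes "v \<in> permutahedron_verts n" "w \<in> neighbours n v"
  shows "evenperm w \<longleftrightarrow> \<not> evenperm v"
  using assms evenperm_adj_swap_comp by (auto simp: neighbours_eq)

lemma card_permutahedron_verts: "card (permutahedron_verts n) = fact (n + 1)"
  unfolding permutahedron_verts_def by (rule card_permutations) auto

section \<open>Connectedness\<close>

definition kept_arcs :: "nat \<Rightarrow> ((nat \<Rightarrow> nat) set \<Rightarrow> bool) \<Rightarrow> ((nat \<Rightarrow> nat) \<times> (nat \<Rightarrow> nat)) set" where
  "kept_arcs n keep = {(u, v). {u, v} \<in> permutahedron_edges n \<and> keep {u, v}}"

lemma kept_arcs_rtrancl_sym: "(u, v) \<in> (kept_arcs n keep)\<^sup>* \<Longrightarrow> (v, u) \<in> (kept_arcs n keep)\<^sup>*"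
proof -
  have "sym (kept_arcs n keep)"
    by (auto simp: kept_arcs_def insert_commute intro: symI)
  then show "(u, v) \<in> (kept_arcs n keep)\<^sup>* \<Longrightarrow> (v, u) \<in> (kept_arcs n keep)\<^sup>*"
    by (metis sym_rtrancl symE)
qed

text \<open>Library connectedness is strong connectedness of the symmetric closure. Here the arc
  relation is already symmetric, so it reduces to reachability along arcs; the library notion also
  demands a vertex, hence \<open>V \<noteq> {}\<close>.\<close>

lemma connected_undirected_graph_iff:
  assumes "\<And>e. e \<in> E \<Longrightarrow> e \<subseteq> V" "V \<noteq> {}"
  shows "Digraph_Component.connected (with_proj (undirected_graph V E)) \<longleftrightarrow>
    (\<forall>u\<in>V. \<forall>v\<in>V. (u, v) \<in> {(u, v). {u, v} \<in> E}\<^sup>*)"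
proof -
  let ?G = "undirected_graph V E"
  interpret pair_wf_digraph ?G
    by unfold_locales (use assms(1) in \<open>fastforce simp: undirected_graph_def\<close>)+
  have "symmetric (with_proj ?G)"
    by (auto simp: symmetric_def undirected_graph_def insert_commute intro: symI)
  then have "u \<rightarrow>\<^sup>*\<^bsub>mk_symmetric ?G\<^esub> v \<longleftrightarrow> u \<in> V \<and> v \<in> V \<and> (u, v) \<in> {(u, v). {u, v} \<in> E}\<^sup>*" for u v
    using reachable_mk_symmetric_eq[of u v] reachable_conv[of u v]
    by (auto simp: undirected_graph_def)
  then show ?thesis
    using assms(2) by (auto simp: Digraph_Component.connected_def strongly_connected_def undirected_graph_def)
qed

definition kept_connected :: "nat \<Rightarrow> ((nat \<Rightarrow> nat) set \<Rightarrow> bool) \<Rightarrow> bool" where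
  "kept_connected n keep \<longleftrightarrow>
     (\<forall>u\<in>permutahedron_verts n. \<forall>v\<in>permutahedron_verts n. (u, v) \<in> (kept_arcs n keep)\<^sup>*)"

lemma id_in_verts: "id \<in> permutahedron_verts n"
  by (simp add: permutahedron_verts_def permutes_id)

lemma connected_iff_kept_connected:
  "Digraph_Component.connected (with_proj
     (undirected_graph (permutahedron_verts n) {e \<in> permutahedron_edges n. keep e})) \<longleftrightarrow>
   kept_connected n keep"
proof (subst connected_undirected_graph_iff)
  show "e \<subseteq> permutahedron_verts n" if "e \<in> {e \<in> permutahedron_edges n. keep e}" for e
    using that permutahedron_edge(1) by blast
  show "permutahedron_verts n \<noteq> {}"
    using id_in_verts by blast
qed (simp add: kept_connected_def kept_arcs_def)

text \<open>Conjugating \<open>(a b)\<close> by the adjacent swap of \<open>b\<close> and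
  \<open>b + 1\<close> gives \<open>(a b+1)\<close>; so, by induction on the distance, adjacent
  swaps give all transpositions and hence all permutations. Asking only for steps in
  \<open>R\<^sup>*\<close> lets a deleted edge be replaced by a detour.\<close>

lemma adjacent_swaps_generate:
  assumes sym: "\<And>u v. (u, v) \<in> R\<^sup>* \<Longrightarrow> (v, u) \<in> R\<^sup>*"
    and step: "\<And>u i. u \<in> permutahedron_verts n \<Longrightarrow> i \<in> {1..n} \<Longrightarrow> (u, adj_swap i \<circ> u) \<in> R\<^sup>*"
    and "u \<in> permutahedron_verts n" "v \<in> permutahedron_verts n"
  shows "(u, v) \<in> R\<^sup>*"
proof -
  have swap: "(u, Transposition.transpose a (Suc a + d) \<circ> u) \<in> R\<^sup>*"
    if "u \<in> permutahedron_verts n" "1 \<le> a" "Suc a + d \<le> n + 1" for u a d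
    using that
  proof (induction d arbitrary: u)
    case 0
    then show ?case
      using step[of u a] by (simp add: adj_swap_def comp_def)
  next
    case (Suc d)
    let ?b = "Suc a + d"
    define s where "s = adj_swap ?b"
    define t where "t = Transposition.transpose a ?b"
    have eq: "Transposition.transpose a (Suc a + Suc d) \<circ> u = s \<circ> (t \<circ> (s \<circ> u))"
      by (auto simp: s_def t_def adj_swap_def Transposition.transpose_def fun_eq_iff)
    have V: "s \<circ> u \<in> permutahedron_verts n"
      using Suc.prems adj_swap_comp_in_verts unfolding s_def by simp
    have "t permutes {1..n + 1}"
      using Suc.prems unfolding t_def by (intro permutes_swap_id) auto
    then have V': "t \<circ> (s \<circ> u) \<in> permutahedron_verts n"
      using V by (auto simp: permutahedron_verts_def intro: permutes_compose)
    have "(u, s \<circ> u) \<in> R\<^sup>*"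
      using step Suc.prems unfolding s_def by simp
    also have "(s \<circ> u, t \<circ> (s \<circ> u)) \<in> R\<^sup>*"
      using Suc.IH[OF V] Suc.prems by (simp add: t_def comp_def)
    also have "(t \<circ> (s \<circ> u), s \<circ> (t \<circ> (s \<circ> u))) \<in> R\<^sup>*"
      using step[OF V'] Suc.prems unfolding s_def by simp
    finally show ?case
      using eq by (simp add: comp_def fun_eq_iff)
  qed
  have swap': "(u, Transposition.transpose a b \<circ> u) \<in> R\<^sup>*"
    if "u \<in> permutahedron_verts n" "a \<in> {1..n + 1}" "b \<in> {1..n + 1}" "a < b" for u a b
    using swap[of u a "b - Suc a"] that by simp
  have "(id, v) \<in> R\<^sup>*" if "v permutes {1..n + 1}" for v
    using that finite_atLeastAtMost
  proof (induction v rule: permutes_induct)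
    case (swap a b \<pi>)
    have "(\<pi>, Transposition.transpose a b \<circ> \<pi>) \<in> R\<^sup>*"
      using swap' swap.hyps transpose_commute
      by (metis (mono_tags, lifting) mem_Collect_eq nat_neq_iff permutahedron_verts_def)
    with swap.IH show ?case
      by (simp add: comp_def)
  qed auto
  then have "(id, u) \<in> R\<^sup>*" "(id, v) \<in> R\<^sup>*"
    using assms(3,4) by (auto simp: permutahedron_verts_def)
  then show ?thesis
    using sym[of id u] by simp
qed

section \<open>Local connections\<close>

definition closed_edges :: "nat \<Rightarrow> ((nat \<Rightarrow> nat) set \<Rightarrow> bool) \<Rightarrow> (nat \<Rightarrow> nat) set set" where
  "closed_edges n keep = {e \<in> permutahedron_edges n. \<not> keep e}"

definition poor :: "nat \<Rightarrow> ((nat \<Rightarrow> nat) set \<Rightarrow> bool) \<Rightarrow> (nat \<Rightarrow> nat) \<Rightarrow> bool" where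
  "poor n keep v \<longleftrightarrow> 3 * n < 4 * card (vertex_star n v \<inter> closed_edges n keep)"

text \<open>The four families are the second to fifth edges of the six-step walks used in
  \<open>detour\<close>. The intersection discards the singletons that arise when \<open>a\<close>
  or \<open>b\<close> is 0.\<close>

definition detour_edges :: "nat \<Rightarrow> (nat \<Rightarrow> nat) \<Rightarrow> nat \<Rightarrow> nat \<Rightarrow> (nat \<Rightarrow> nat) set set" where
  "detour_edges n x a b = permutahedron_edges n \<inter>
     ((\<lambda>(i, k). perm_edge (adj_swap i \<circ> (adj_swap a \<circ> x)) k) ` ({1..n} \<times> {1..n}) \<union>
      (\<lambda>(i, k). perm_edge (adj_swap k \<circ> adj_swap i \<circ> x) a) ` ({1..n} \<times> {1..n}) \<union>
      (\<lambda>(i, k). perm_edge (adj_swap k \<circ> adj_swap i \<circ> x) b) ` ({1..n} \<times> {1..n}) \<union>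
      (\<lambda>(i, k). perm_edge (adj_swap k \<circ> (adj_swap b \<circ> x)) i) ` ({1..n} \<times> {1..n}))"

lemma card_detour_edges: "card (detour_edges n x a b) \<le> 4 * n\<^sup>2"
proof -
  let ?I = "{1..n} \<times> {1..n}"
  have im: "card (f ` ?I) \<le> n\<^sup>2" "finite (f ` ?I)" for f :: "nat \<times> nat \<Rightarrow> (nat \<Rightarrow> nat) set"
    using card_image_le[of ?I f] by (auto simp: power2_eq_square)
  have "card (detour_edges n x a b) \<le>
      card ((\<lambda>(i, k). perm_edge (adj_swap i \<circ> (adj_swap a \<circ> x)) k) ` ?I \<union>
      (\<lambda>(i, k). perm_edge (adj_swap k \<circ> adj_swap i \<circ> x) a) ` ?I \<union>
      (\<lambda>(i, k). perm_edge (adj_swap k \<circ> adj_swap i \<circ> x) b) ` ?I \<union>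
      (\<lambda>(i, k). perm_edge (adj_swap k \<circ> (adj_swap b \<circ> x)) i) ` ?I)" (is "_ \<le> card (?A \<union> ?B \<union> ?C \<union> ?D)")
    unfolding detour_edges_def by (intro card_mono) auto
  also have "\<dots> \<le> card ?A + card ?B + card ?C + card ?D"
    by (meson add_le_mono1 card_Un_le le_trans)
  also have "\<dots> \<le> n\<^sup>2 + n\<^sup>2 + n\<^sup>2 + n\<^sup>2"
    using im by (intro add_mono)
  finally show ?thesis
    by simp
qed

lemma kept_step:
  assumes "x \<in> permutahedron_verts n" "i \<le> n" "perm_edge x i \<notin> closed_edges n keep"
  shows "(x, adj_swap i \<circ> x) \<in> (kept_arcs n keep)\<^sup>*"
proof (cases "i = 0")
  case False
  then have "perm_edge x i \<in> permutahedron_edges n"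
    using assms perm_edge_in_edges by simp
  then have "(x, adj_swap i \<circ> x) \<in> kept_arcs n keep"
    using assms(3) by (simp add: closed_edges_def kept_arcs_def perm_edge_def)
  then show ?thesis
    by blast
qed simp

definition open_indices :: "nat \<Rightarrow> ((nat \<Rightarrow> nat) set \<Rightarrow> bool) \<Rightarrow> (nat \<Rightarrow> nat) \<Rightarrow> nat set" where
  "open_indices n keep v = {i \<in> {1..n}. perm_edge v i \<notin> closed_edges n keep}"

lemma card_open_indices:
  assumes "v \<in> permutahedron_verts n" "\<not> poor n keep v"
  shows "n \<le> 4 * card (open_indices n keep v)"
proof -
  let ?C = "{i \<in> {1..n}. perm_edge v i \<in> closed_edges n keep}"
  have "vertex_star n v \<inter> closed_edges n keep = perm_edge v ` ?C"
    unfolding vertex_star_eq[OF assms(1)] by blast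
  moreover have "inj_on (perm_edge v) ?C"
    using inj_on_perm_edge[OF assms(1)] by (rule inj_on_subset) auto
  ultimately have "card (vertex_star n v \<inter> closed_edges n keep) = card ?C"
    by (simp add: card_image)
  moreover have "card (?C \<union> open_indices n keep v) = card ?C + card (open_indices n keep v)"
    by (rule card_Un_disjoint) (auto simp: open_indices_def)
  moreover have "?C \<union> open_indices n keep v = {1..n}"
    by (auto simp: open_indices_def)
  ultimately show ?thesis
    using assms(2) by (simp add: poor_def)
qed

section \<open>Counting detours\<close>

lemma card_remove_interval: "card A \<le> card (A - {a - 1, a, a + 1 :: nat}) + 3"
proof -
  have "card A - card {a - 1, a, a + 1} \<le> card (A - {a - 1, a, a + 1})"
    by (rule diff_card_le_card_Diff) simp
  moreover have "card {a - 1, a, a + 1} \<le> 3"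
    by (simp add: card_insert_if)
  ultimately show ?thesis
    by linarith
qed

text \<open>The excluded values are those of \<open>adj_swap_commute\<close>: \<open>i\<close> and
  \<open>k\<close> commute with \<open>a\<close>, with \<open>b\<close> and with each other.\<close>

definition detour_pairs :: "nat \<Rightarrow> nat \<Rightarrow> nat set \<Rightarrow> nat set \<Rightarrow> (nat \<times> nat) set" where
  "detour_pairs a b I K = {(i, k). i \<in> I - {a - 1, a, a + 1} - {b - 1, b, b + 1} \<and>
     k \<in> K - {a - 1, a, a + 1} - {b - 1, b, b + 1} - {i - 1, i, i + 1}}"

text \<open>Each excluded interval costs at most three indices: there are two intervals for
  \<open>i\<close>, and three for \<open>k\<close> once \<open>i\<close> is chosen.\<close>

lemma card_detour_pairs:
  assumes "finite I" "finite K"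
  shows "(card I - 6) * (card K - 9) \<le> card (detour_pairs a b I K)"
proof -
  let ?I = "I - {a - 1, a, a + 1} - {b - 1, b, b + 1}"
  let ?K = "\<lambda>i. K - {a - 1, a, a + 1} - {b - 1, b, b + 1} - {i - 1, i, i + 1}"
  have I: "card I - 6 \<le> card ?I"
    using card_remove_interval[of I a] card_remove_interval[of "I - {a - 1, a, a + 1}" b] by linarith
  have K: "card K - 9 \<le> card (?K i)" for i
    using card_remove_interval[of K a] card_remove_interval[of "K - {a - 1, a, a + 1}" b]
      card_remove_interval[of "K - {a - 1, a, a + 1} - {b - 1, b, b + 1}" i] by linarith
  have "(card I - 6) * (card K - 9) \<le> card ?I * (card K - 9)"
    using I by simp
  also have "\<dots> \<le> (\<Sum>i\<in>?I. card (?K i))"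
    using K sum_bounded_below[of ?I "card K - 9" "\<lambda>i. card (?K i)"] by simp
  also have "\<dots> = card (Sigma ?I ?K)"
    using assms by (subst card_SigmaI) auto
  also have "Sigma ?I ?K = detour_pairs a b I K"
    by (auto simp: detour_pairs_def)
  finally show ?thesis .
qed

text \<open>Swapping \<open>i\<close> and \<open>k\<close> does not change \<open>adj_swap k \<circ> adj_swap i\<close> when they commute, hence the
  factor \<open>2\<close> below.\<close>

lemma card_pairs_middle:
  assumes x: "x \<in> permutahedron_verts n" and a: "a \<le> n"
    and P: "P \<subseteq> detour_pairs a' b' {1..n} {1..n}" and "finite C"
    and C: "\<And>i k. (i, k) \<in> P \<Longrightarrow>
      perm_edge (adj_swap k \<circ> adj_swap i \<circ> x) a \<in> C \<inter> permutahedron_edges n"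
  shows "card P \<le> 2 * card C"
proof (cases "a = 0")
  case True
  \<comment> \<open>Index 0 gives singletons, which the assumption on \<open>P\<close> would require
    to be edges.\<close>
  then have "P = {}"
    using C perm_edge_0_notin_edges by fastforce
  then show ?thesis
    by simp
next
  case a0: False
  let ?f = "\<lambda>(i, k). perm_edge (adj_swap k \<circ> adj_swap i \<circ> x) a"
  have V: "adj_swap k \<circ> adj_swap i \<circ> x \<in> permutahedron_verts n" if "(i, k) \<in> P" for i k
    using that P x adj_swap_comp_in_verts by (fastforce simp: detour_pairs_def comp_assoc)
  \<comment> \<open>Two swaps restore the parity of \<open>x\<close>, so all base vertices have
    equal parity and \<open>perm_edge_inj\<close> applies: an edge determines the product of the two
    swaps.\<close>
  have even: "evenperm (adj_swap k \<circ> adj_swap i \<circ> x) = evenperm x" if "(i, k) \<in> P" for i k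
  proof -
    have "i \<in> {1..n}" "k \<in> {1..n}"
      using that P by (auto simp: detour_pairs_def)
    then show ?thesis
      using x adj_swap_comp_in_verts[of x n i] evenperm_adj_swap_comp[of x n i]
        evenperm_adj_swap_comp[of "adj_swap i \<circ> x" n k] by (simp add: comp_assoc)
  qed
  have eq: "adj_swap k \<circ> adj_swap i = adj_swap k' \<circ> adj_swap i'"
    if "(i, k) \<in> P" "(i', k') \<in> P" "?f (i, k) = ?f (i', k')" for i k i' k'
    using perm_edge_inj[OF V[OF that(1)] V[OF that(2)], of a a] that(3) a0 even[OF that(1)]
      even[OF that(2)] comp_verts_cancel[OF x] by auto
  have far: "i \<noteq> 0 \<and> k \<noteq> 0 \<and> (i < k \<longrightarrow> i + 2 \<le> k) \<and> (\<not> i < k \<longrightarrow> k + 2 \<le> i)"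
    if "(i, k) \<in> P" for i k
  proof -
    have "(i, k) \<in> detour_pairs a' b' {1..n} {1..n}"
      using that P by blast
    then have "1 \<le> i" "1 \<le> k" "k \<noteq> i - 1" "k \<noteq> i" "k \<noteq> i + 1"
      by (auto simp: detour_pairs_def)
    then show ?thesis
      by linarith
  qed
  have "inj_on ?f {p \<in> P. fst p < snd p}"
  proof (rule inj_onI)
    fix p p' assume "p \<in> {p \<in> P. fst p < snd p}" "p' \<in> {p \<in> P. fst p < snd p}" "?f p = ?f p'"
    moreover obtain i k i' k' where p: "p = (i, k)" "p' = (i', k')"
      by fastforce
    ultimately have *: "(i, k) \<in> P" "(i', k') \<in> P" "?f (i, k) = ?f (i', k')"
      "i < k" "i' < k'"
      by auto
    show "p = p'"
      using adj_swap_pair_inj[of i k i' k'] p eq[OF *(1-3)] far[OF *(1)] far[OF *(2)] *(4,5) by simp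
  qed
  then have 1: "card {p \<in> P. fst p < snd p} \<le> card C"
    by (rule card_inj_on_le) (use C \<open>finite C\<close> in auto)
  have "inj_on ?f {p \<in> P. \<not> fst p < snd p}"
  proof (rule inj_onI)
    fix p p' assume "p \<in> {p \<in> P. \<not> fst p < snd p}" "p' \<in> {p \<in> P. \<not> fst p < snd p}" "?f p = ?f p'"
    moreover obtain i k i' k' where p: "p = (i, k)" "p' = (i', k')"
      by fastforce
    ultimately have *: "(i, k) \<in> P" "(i', k') \<in> P" "?f (i, k) = ?f (i', k')"
      "\<not> i < k" "\<not> i' < k'"
      by auto
    \<comment> \<open>Commuting the factors puts the smaller index first, as
      \<open>adj_swap_pair_inj\<close> expects.\<close>
    have "adj_swap i \<circ> adj_swap k = adj_swap k \<circ> adj_swap i" if "k + 2 \<le> i" for i k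
      using that adj_swap_commute[of i k] by (simp add: fun_eq_iff)
    then have "adj_swap i \<circ> adj_swap k = adj_swap i' \<circ> adj_swap k'"
      using eq[OF *(1-3)] far[OF *(1)] far[OF *(2)] *(4,5) by metis
    then show "p = p'"
      using adj_swap_pair_inj[of k i k' i'] p far[OF *(1)] far[OF *(2)] *(4,5) by simp
  qed
  then have 2: "card {p \<in> P. \<not> fst p < snd p} \<le> card C"
    by (rule card_inj_on_le) (use C \<open>finite C\<close> in auto)
  have "finite P"
    using P by (rule finite_subset) (auto simp: detour_pairs_def intro: finite_subset[of _ "{1..n} \<times> {1..n}"])
  then have "card ({p \<in> P. fst p < snd p} \<union> {p \<in> P. \<not> fst p < snd p}) =
      card {p \<in> P. fst p < snd p} + card {p \<in> P. \<not> fst p < snd p}"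
    by (intro card_Un_disjoint) auto
  moreover have "{p \<in> P. fst p < snd p} \<union> {p \<in> P. \<not> fst p < snd p} = P"
    by auto
  ultimately show ?thesis
    using 1 2 by simp
qed

text \<open>All \<open>adj_swap i \<circ> v\<close> have the parity opposite to \<open>v\<close>, so
  an edge reveals its base, hence \<open>i\<close>, and its direction \<open>k\<close>. In contrast
  to the middle edges, the order of \<open>i\<close> and \<open>k\<close> is visible.\<close>

lemma card_pairs_end:
  assumes v: "v \<in> permutahedron_verts n" and P: "P \<subseteq> {1..n} \<times> {1..n}" and "finite C"
    and C: "\<And>i k. (i, k) \<in> P \<Longrightarrow> perm_edge (adj_swap i \<circ> v) k \<in> C"
  shows "card P \<le> card C"
proof (rule card_inj_on_le)
  show "inj_on (\<lambda>(i, k). perm_edge (adj_swap i \<circ> v) k) P"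
  proof (rule inj_onI, clarify)
    fix i k i' k' assume *: "(i, k) \<in> P" "(i', k') \<in> P"
      "perm_edge (adj_swap i \<circ> v) k = perm_edge (adj_swap i' \<circ> v) k'"
    have "i \<in> {1..n}" "i' \<in> {1..n}" "k \<noteq> 0" "k' \<noteq> 0"
      using * P by auto
    then have "adj_swap i \<circ> v = adj_swap i' \<circ> v \<and> k = k'"
      using * v by (intro perm_edge_inj[of _ n])
        (auto simp: adj_swap_comp_in_verts evenperm_adj_swap_comp)
    then show "i = i' \<and> k = k'"
      using comp_verts_cancel[OF v] inj_adj_swap by blast
  qed
next
  show "(\<lambda>(i, k). perm_edge (adj_swap i \<circ> v) k) ` P \<subseteq> C"
    using C by auto
qed fact

lemma finite_closed_edges: "finite (closed_edges n keep)"
  unfolding closed_edges_def using finite_permutahedron_edges by simp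

text \<open>For indices \<open>i\<close>, \<open>k\<close> commuting with \<open>a\<close>, \<open>b\<close> and each other, there is the walk
  \<open>v, \<tau>\<^sub>i v, \<tau>\<^sub>k \<tau>\<^sub>i v = \<tau>\<^sub>a y, y, \<tau>\<^sub>b y = \<tau>\<^sub>i \<tau>\<^sub>k w, \<tau>\<^sub>k w, w\<close> where \<open>v = \<tau>\<^sub>a x\<close>, \<open>w = \<tau>\<^sub>b x\<close> and
  \<open>y = \<tau>\<^sub>k \<tau>\<^sub>i x\<close>. If \<open>v\<close> and \<open>w\<close> are not poor, then the first and last step are kept for
  quadratically many pairs \<open>(i, k)\<close>, so blocking all these walks takes quadratically many closed
  edges.\<close>

lemma detour:
  assumes x: "x \<in> permutahedron_verts n" and ab: "a \<le> n" "b \<le> n"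
    and poor: "\<not> poor n keep (adj_swap a \<circ> x)" "\<not> poor n keep (adj_swap b \<circ> x)"
    and few: "384 * card (detour_edges n x a b \<inter> closed_edges n keep) < n\<^sup>2" and n: "72 \<le> n"
  shows "(adj_swap a \<circ> x, adj_swap b \<circ> x) \<in> (kept_arcs n keep)\<^sup>*"
proof -
  define v where "v = adj_swap a \<circ> x"
  define w where "w = adj_swap b \<circ> x"
  define Cl where "Cl = detour_edges n x a b \<inter> closed_edges n keep"
  define P where "P = detour_pairs a b (open_indices n keep v) (open_indices n keep w)"
  have V: "v \<in> permutahedron_verts n" "w \<in> permutahedron_verts n"
    using x ab adj_swap_comp_in_verts by (auto simp: v_def w_def)
  have "finite Cl"
    unfolding Cl_def using finite_closed_edges by simp
  have PP: "P \<subseteq> detour_pairs a b {1..n} {1..n}"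
    unfolding P_def detour_pairs_def open_indices_def by auto
  have P': "P \<subseteq> {1..n} \<times> {1..n}"
    using PP by (auto simp: detour_pairs_def)
  then have "finite P"
    by (rule finite_subset) simp
  \<comment> \<open>At least \<open>n / 4\<close> indices are open at \<open>v\<close> and at
    \<open>w\<close>. After losing up to 9 of them at least \<open>n / 8\<close> remain, because
    \<open>n \<ge> 72 = 8 * 9\<close>.\<close>
  have "n\<^sup>2 \<le> (8 * (card (open_indices n keep v) - 6)) * (8 * (card (open_indices n keep w) - 9))"
    unfolding power2_eq_square
    using card_open_indices[OF V(1), of keep] card_open_indices[OF V(2), of keep] poor n
    by (intro mult_mono) (auto simp: v_def w_def)
  also have "\<dots> \<le> 64 * card P"
    using card_detour_pairs[of "open_indices n keep v" "open_indices n keep w" a b]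
    by (simp add: P_def open_indices_def)
  finally have large: "n\<^sup>2 \<le> 64 * card P" .
  define P1 where "P1 = {(i, k) \<in> P. perm_edge (adj_swap i \<circ> v) k \<in> closed_edges n keep}"
  define P2 where "P2 = {(i, k) \<in> P. perm_edge (adj_swap k \<circ> adj_swap i \<circ> x) a \<in> closed_edges n keep}"
  define P3 where "P3 = {(i, k) \<in> P. perm_edge (adj_swap k \<circ> adj_swap i \<circ> x) b \<in> closed_edges n keep}"
  define P4 where "P4 = {(i, k) \<in> P. perm_edge (adj_swap k \<circ> w) i \<in> closed_edges n keep}"
  have sub: "P1 \<subseteq> P" "P2 \<subseteq> P" "P3 \<subseteq> P" "P4 \<subseteq> P"
    by (auto simp: P1_def P2_def P3_def P4_def)
  have E: "closed_edges n keep \<subseteq> permutahedron_edges n"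
    by (auto simp: closed_edges_def)
  have 1: "card P1 \<le> card Cl"
    using sub P' E \<open>finite Cl\<close>
    by (intro card_pairs_end[OF V(1)]) (auto simp: P1_def Cl_def detour_edges_def v_def)
  \<comment> \<open>Seen from \<open>w\<close> the walk uses \<open>k\<close> first and
    \<open>i\<close> second, hence the exchange of components.\<close>
  have "card (prod.swap ` P4) \<le> card Cl"
    using sub P' E \<open>finite Cl\<close>
    by (intro card_pairs_end[OF V(2)]) (auto simp: P4_def Cl_def detour_edges_def w_def)
  then have 4: "card P4 \<le> card Cl"
    by (simp add: card_image)
  have 2: "card P2 \<le> 2 * card Cl"
    using sub PP P' E \<open>finite Cl\<close>
    by (intro card_pairs_middle[OF x ab(1)]) (auto simp: P2_def Cl_def detour_edges_def)
  have 3: "card P3 \<le> 2 * card Cl"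
    using sub PP P' E \<open>finite Cl\<close>
    by (intro card_pairs_middle[OF x ab(2)]) (auto simp: P3_def Cl_def detour_edges_def)
  have "card (P1 \<union> P2 \<union> P3 \<union> P4) \<le> card P1 + card P2 + card P3 + card P4"
    by (meson add_le_mono1 card_Un_le le_trans)
  \<comment> \<open>The bounds add up to \<open>6 * card Cl\<close>, and \<open>64 * 6 = 384\<close>
    is the constant in \<open>few\<close>.\<close>
  then have "card (P1 \<union> P2 \<union> P3 \<union> P4) < card P"
    using 1 2 3 4 large few unfolding Cl_def by linarith
  then have "P1 \<union> P2 \<union> P3 \<union> P4 \<noteq> P"
    by blast
  then obtain i k where ik: "(i, k) \<in> P" and nc: "(i, k) \<notin> P1" "(i, k) \<notin> P2" "(i, k) \<notin> P3" "(i, k) \<notin> P4"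
    using sub by auto
  have far: "i \<notin> {a - 1, a, a + 1}" "i \<notin> {b - 1, b, b + 1}" "k \<notin> {a - 1, a, a + 1}"
      "k \<notin> {b - 1, b, b + 1}" "k \<notin> {i - 1, i, i + 1}"
    and open_ik: "i \<in> open_indices n keep v" "k \<in> open_indices n keep w"
    using ik unfolding P_def detour_pairs_def by auto
  have le: "i \<le> n" "k \<le> n"
    using ik P' by auto
  define y where "y = adj_swap k \<circ> adj_swap i \<circ> x"
  have y: "y \<in> permutahedron_verts n"
    using x le adj_swap_comp_in_verts by (simp add: y_def comp_assoc)
  have yv: "adj_swap k \<circ> (adj_swap i \<circ> v) = adj_swap a \<circ> y"
    using far adj_swap_commute[of i a] adj_swap_commute[of k a] by (simp add: y_def v_def fun_eq_iff)
  have yw: "adj_swap i \<circ> (adj_swap k \<circ> w) = adj_swap b \<circ> y"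
    using far adj_swap_commute[of i b] adj_swap_commute[of k b] adj_swap_commute[of k i]
    by (simp add: y_def w_def fun_eq_iff)
  have "(v, adj_swap i \<circ> v) \<in> (kept_arcs n keep)\<^sup>*"
    using open_ik le V by (intro kept_step) (auto simp: open_indices_def)
  also have "(adj_swap i \<circ> v, adj_swap a \<circ> y) \<in> (kept_arcs n keep)\<^sup>*"
    unfolding yv[symmetric] using le V nc(1) ik
    by (intro kept_step) (auto simp: P1_def adj_swap_comp_in_verts)
  also have "(adj_swap a \<circ> y, y) \<in> (kept_arcs n keep)\<^sup>*"
    using nc(2) ik y ab by (intro kept_arcs_rtrancl_sym[OF kept_step]) (auto simp: P2_def y_def)
  also have "(y, adj_swap b \<circ> y) \<in> (kept_arcs n keep)\<^sup>*"
    using nc(3) ik y ab by (intro kept_step) (auto simp: P3_def y_def)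
  also have "(adj_swap b \<circ> y, adj_swap k \<circ> w) \<in> (kept_arcs n keep)\<^sup>*"
    unfolding yw[symmetric] using le V nc(4) ik
    by (intro kept_arcs_rtrancl_sym[OF kept_step]) (auto simp: P4_def adj_swap_comp_in_verts)
  also have "(adj_swap k \<circ> w, w) \<in> (kept_arcs n keep)\<^sup>*"
    using open_ik le V by (intro kept_arcs_rtrancl_sym[OF kept_step]) (auto simp: open_indices_def)
  finally show ?thesis
    by (simp add: v_def w_def)
qed

section \<open>From detours to connectedness\<close>

definition isolated :: "nat \<Rightarrow> ((nat \<Rightarrow> nat) set \<Rightarrow> bool) \<Rightarrow> (nat \<Rightarrow> nat) \<Rightarrow> bool" where
  "isolated n keep v \<longleftrightarrow> (\<forall>e\<in>vertex_star n v. \<not> keep e)"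

text \<open>For \<open>n = 0\<close> the only vertex has an empty star and counts as isolated
  although the graph is connected; \<open>1 \<le> n\<close> supplies a second vertex.\<close>

lemma kept_connected_no_isolated:
  assumes "kept_connected n keep" "v \<in> permutahedron_verts n" "1 \<le> n"
  shows "\<not> isolated n keep v"
proof
  assume iso: "isolated n keep v"
  let ?w = "adj_swap 1 \<circ> v"
  have w: "?w \<in> permutahedron_verts n"
    using assms adj_swap_comp_in_verts by simp
  have "v \<noteq> ?w"
    using evenperm_adj_swap_comp[OF assms(2), of 1] by auto
  moreover have "(v, ?w) \<in> (kept_arcs n keep)\<^sup>*"
    using assms w by (auto simp: kept_connected_def)
  ultimately obtain z where "(v, z) \<in> kept_arcs n keep"
    by (meson converse_rtranclE)
  then show False
    using iso by (auto simp: kept_arcs_def isolated_def vertex_star_def)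
qed

text \<open>The deterministic core: under these conditions the ends of every edge, kept or deleted,
  are linked, and adjacent swaps generate.\<close>

lemma kept_connectedI:
  assumes n: "72 \<le> n"
    and iso: "\<And>v. v \<in> permutahedron_verts n \<Longrightarrow> \<not> isolated n keep v"
    and poor: "\<And>v w. v \<in> permutahedron_verts n \<Longrightarrow> w \<in> neighbours n v \<Longrightarrow>
      \<not> (poor n keep v \<and> poor n keep w)"
    and few: "\<And>x a b. x \<in> permutahedron_verts n \<Longrightarrow> a \<le> n \<Longrightarrow> b \<le> n \<Longrightarrow>
      384 * card (detour_edges n x a b \<inter> closed_edges n keep) < n\<^sup>2"
  shows "kept_connected n keep"
proof -
  let ?R = "(kept_arcs n keep)\<^sup>*"
  have poor': "\<not> (poor n keep u \<and> poor n keep (adj_swap b \<circ> u))"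
    if "u \<in> permutahedron_verts n" "b \<in> {1..n}" for u b
    using poor[of u] that neighbours_eq by blast
  have step_poor: "(u, adj_swap b \<circ> u) \<in> ?R"
    if u: "u \<in> permutahedron_verts n" and b: "b \<in> {1..n}" and p: "poor n keep u" for u b
  proof -
    obtain a where a: "a \<in> {1..n}" "keep (perm_edge u a)"
      using iso[OF u] by (auto simp: isolated_def vertex_star_eq[OF u])
    \<comment> \<open>Both vertices are neighbours of the poor vertex \<open>u\<close>, so neither
      of them is poor and \<open>detour\<close> applies around \<open>u\<close>.\<close>
    have "(adj_swap a \<circ> u, adj_swap b \<circ> u) \<in> ?R"
      using a b u p poor' few n by (intro detour) auto
    moreover have "(u, adj_swap a \<circ> u) \<in> ?R"
      using a u by (intro kept_step) (auto simp: closed_edges_def)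
    ultimately show ?thesis
      by simp
  qed
  have "(u, adj_swap b \<circ> u) \<in> ?R" if u: "u \<in> permutahedron_verts n" and b: "b \<in> {1..n}" for u b
  proof -
    let ?v = "adj_swap b \<circ> u"
    have v: "?v \<in> permutahedron_verts n"
      using u b adj_swap_comp_in_verts by simp
    consider "poor n keep u" | "poor n keep ?v" | "\<not> poor n keep u" "\<not> poor n keep ?v"
      by blast
    then show ?thesis
    proof cases
      case 1
      then show ?thesis using step_poor u b by blast
    next
      case 2
      have "(?v, adj_swap b \<circ> ?v) \<in> ?R"
        using step_poor[OF v b 2] .
      then show ?thesis
        using kept_arcs_rtrancl_sym[of ?v u] by simp
    next
      case 3
      \<comment> \<open>With index 0 the vertex \<open>u\<close> is itself
        \<open>adj_swap 0 \<circ> u\<close>, so \<open>detour\<close> also links \<open>u\<close> to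
        its neighbour.\<close>
      then show ?thesis
        using detour[of u n 0 b keep] u b few n by simp
    qed
  qed
  then show ?thesis
    unfolding kept_connected_def using adjacent_swaps_generate kept_arcs_rtrancl_sym by blast
qed

section \<open>Independent coin flips\<close>

text \<open>The library product rule is applied to countable sets, so both factors are first cut
  down to the supports.\<close>

lemma prob_pair_pmf_Times:
  "measure_pmf.prob (pair_pmf M N) (A \<times> B) = measure_pmf.prob M A * measure_pmf.prob N B"
proof -
  have "measure_pmf.prob (pair_pmf M N) (A \<times> B) =
      measure_pmf.prob (pair_pmf M N) ((A \<times> B) \<inter> set_pmf (pair_pmf M N))"
    by (rule measure_Int_set_pmf[symmetric])
  also have "(A \<times> B) \<inter> set_pmf (pair_pmf M N) = (A \<inter> set_pmf M) \<times> (B \<inter> set_pmf N)"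
    by auto
  also have "measure_pmf.prob (pair_pmf M N) \<dots> =
      measure_pmf.prob M (A \<inter> set_pmf M) * measure_pmf.prob N (B \<inter> set_pmf N)"
    by (intro measure_pmf_prob_product countable_Int2) simp_all
  finally show ?thesis
    by (simp add: measure_Int_set_pmf)
qed

abbreviation coins :: "'a set \<Rightarrow> real \<Rightarrow> ('a \<Rightarrow> bool) pmf" where
  "coins E p \<equiv> Pi_pmf E False (\<lambda>_. bernoulli_pmf p)"

text \<open>The last assumption says that \<open>Q\<close> ignores coordinate \<open>e\<close>.
  Drawing that coin separately turns the event into a product.\<close>

lemma prob_coin_False:
  assumes "finite E" "p \<in> {0..1}" "e \<in> E" "\<And>f y. Q (f(e := y)) = Q f"
  shows "measure_pmf.prob (coins E p) {f. \<not> f e \<and> Q f} = (1 - p) * measure_pmf.prob (coins E p) {f. Q f}"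
proof -
  have E: "coins E p = map_pmf (\<lambda>(y, f). f(e := y)) (pair_pmf (bernoulli_pmf p) (coins (E - {e}) p))"
    using Pi_pmf_insert[of "E - {e}" e False "\<lambda>_. bernoulli_pmf p"] assms by (simp add: insert_absorb)
  have "(\<lambda>(y, f). f(e := y)) -` {f. \<not> f e \<and> Q f} = {False} \<times> {f. Q f}"
    "(\<lambda>(y, f). f(e := y)) -` {f. Q f} = UNIV \<times> {f. Q f}"
    using assms(4) by auto
  then show ?thesis
    unfolding E measure_map_pmf using assms(2) by (simp add: prob_pair_pmf_Times measure_pmf_single)
qed

lemma prob_coins_False:
  assumes "finite E" "p \<in> {0..1}" "A \<subseteq> E"
    and "\<And>f g. (\<And>e. e \<notin> A \<Longrightarrow> f e = g e) \<Longrightarrow> Q f = Q g"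
  shows "measure_pmf.prob (coins E p) {f. (\<forall>e\<in>A. \<not> f e) \<and> Q f} =
    (1 - p) ^ card A * measure_pmf.prob (coins E p) {f. Q f}"
proof -
  have "finite A"
    using assms finite_subset by blast
  then show ?thesis
    using assms(3,4)
  proof (induction A rule: finite_induct)
    case empty
    show ?case
      by simp
  next
    case (insert e A)
    have Q: "Q f = Q g" if "\<And>e. e \<notin> A \<Longrightarrow> f e = g e" for f g
      using that insert.prems(2)[of f g] by blast
    have Q': "Q (f(e := y)) = Q f" for f y
      by (rule insert.prems(2)) auto
    have "measure_pmf.prob (coins E p) {f. \<not> f e \<and> (\<forall>e\<in>A. \<not> f e) \<and> Q f} =
        (1 - p) * measure_pmf.prob (coins E p) {f. (\<forall>e\<in>A. \<not> f e) \<and> Q f}"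
      using insert.hyps insert.prems(1) Q' by (intro prob_coin_False[OF assms(1,2)]) auto
    moreover have "measure_pmf.prob (coins E p) {f. (\<forall>e\<in>A. \<not> f e) \<and> Q f} =
        (1 - p) ^ card A * measure_pmf.prob (coins E p) {f. Q f}"
      using insert.prems(1) by (intro insert.IH Q) auto
    moreover have "{f. (\<forall>e\<in>insert e A. \<not> f e) \<and> Q f} = {f. \<not> f e \<and> (\<forall>e\<in>A. \<not> f e) \<and> Q f}"
      by auto
    ultimately show ?case
      by (simp only: card_insert_disjoint[OF insert.hyps] power_Suc mult.assoc)
  qed
qed

lemma prob_all_False:
  assumes "finite E" "p \<in> {0..1}" "A \<subseteq> E"
  shows "measure_pmf.prob (coins E p) {f. \<forall>e\<in>A. \<not> f e} = (1 - p) ^ card A"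
  using prob_coins_False[OF assms, of "\<lambda>_. True"] by simp

text \<open>Union bound over the \<open>m\<close>-element subsets of \<open>F\<close>, counted
  crudely by \<open>2 ^ card F\<close>; the smallness of \<open>1 - p\<close> absorbs this factor
  later.\<close>

lemma prob_many_False:
  assumes "finite E" "p \<in> {0..1}" "F \<subseteq> E"
  shows "measure_pmf.prob (coins E p) {f. m \<le> card {e \<in> F. \<not> f e}} \<le> 2 ^ card F * (1 - p) ^ m"
proof -
  have "finite F"
    using assms finite_subset by blast
  let ?S = "{A \<in> Pow F. card A = m}"
  have "{f. m \<le> card {e \<in> F. \<not> f e}} \<subseteq> (\<Union>A\<in>?S. {f. \<forall>e\<in>A. \<not> f e})"
  proof
    fix f assume "f \<in> {f. m \<le> card {e \<in> F. \<not> f e}}"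
    then obtain A where "A \<subseteq> {e \<in> F. \<not> f e}" "card A = m"
      using obtain_subset_with_card_n[of m "{e \<in> F. \<not> f e}"] by auto
    then show "f \<in> (\<Union>A\<in>?S. {f. \<forall>e\<in>A. \<not> f e})"
      by auto
  qed
  then have "measure_pmf.prob (coins E p) {f. m \<le> card {e \<in> F. \<not> f e}} \<le>
      measure_pmf.prob (coins E p) (\<Union>A\<in>?S. {f. \<forall>e\<in>A. \<not> f e})"
    by (intro measure_pmf.finite_measure_mono) auto
  also have "\<dots> \<le> (\<Sum>A\<in>?S. measure_pmf.prob (coins E p) {f. \<forall>e\<in>A. \<not> f e})"
    using \<open>finite F\<close> by (intro measure_pmf.finite_measure_subadditive_finite) auto
  also have "\<dots> = (\<Sum>A\<in>?S. (1 - p) ^ m)"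
    using assms by (intro sum.cong) (auto simp: prob_all_False)
  also have "\<dots> = real (card ?S) * (1 - p) ^ m"
    by simp
  also have "\<dots> \<le> 2 ^ card F * (1 - p) ^ m"
  proof (rule mult_right_mono)
    have "card ?S \<le> card (Pow F)"
      using \<open>finite F\<close> by (intro card_mono) auto
    then show "real (card ?S) \<le> 2 ^ card F"
      using \<open>finite F\<close> by (simp add: card_Pow)
  qed (use assms in auto)
  finally show ?thesis .
qed

section \<open>Isolated vertices\<close>

abbreviation percolation :: "nat \<Rightarrow> real \<Rightarrow> ((nat \<Rightarrow> nat) set \<Rightarrow> bool) pmf" where
  "percolation n p \<equiv> coins (permutahedron_edges n) p"

lemma prob_connected_eq:
  "measure_pmf.prob (random_permutahedron n p) {G. Digraph_Component.connected (with_proj G)} =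
   measure_pmf.prob (percolation n p) {keep. kept_connected n keep}"
  unfolding random_permutahedron_def measure_map_pmf
  by (rule arg_cong[where f = "measure_pmf.prob _"]) (auto simp: connected_iff_kept_connected)

definition none_isolated :: "nat \<Rightarrow> (nat \<Rightarrow> nat) set \<Rightarrow> ((nat \<Rightarrow> nat) set \<Rightarrow> bool) set" where
  "none_isolated n U = {keep. \<forall>v\<in>U. \<not> isolated n keep v}"

definition poor_pair :: "nat \<Rightarrow> ((nat \<Rightarrow> nat) set \<Rightarrow> bool) set" where
  "poor_pair n = (\<Union>v\<in>permutahedron_verts n. \<Union>w\<in>neighbours n v. {keep. poor n keep v \<and> poor n keep w})"

text \<open>The negation of the last condition of \<open>kept_connectedI\<close>. The indices
  include 0 because \<open>detour\<close> is also used with \<open>a = 0\<close>.\<close>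

definition blocked_detour :: "nat \<Rightarrow> ((nat \<Rightarrow> nat) set \<Rightarrow> bool) set" where
  "blocked_detour n = (\<Union>(x, a, b)\<in>permutahedron_verts n \<times> {..n} \<times> {..n}.
     {keep. n\<^sup>2 \<le> 384 * card (detour_edges n x a b \<inter> closed_edges n keep)})"

context
  fixes n :: nat and p :: real
  assumes p: "p \<in> {0..1}"
begin

lemma prob_isolated:
  "v \<in> permutahedron_verts n \<Longrightarrow>
   measure_pmf.prob (percolation n p) {keep. isolated n keep v} = (1 - p) ^ n"
  using prob_all_False[OF finite_permutahedron_edges p vertex_star_subset, of n v]
  by (simp add: isolated_def card_vertex_star)

lemma prob_both_isolated:
  assumes "v \<in> permutahedron_verts n" "w \<in> permutahedron_verts n" "v \<noteq> w"
  shows "measure_pmf.prob (percolation n p) {keep. isolated n keep v \<and> isolated n keep w} \<le>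
    (1 - p) ^ (2 * n - 1)"
proof -
  have "{keep. isolated n keep v \<and> isolated n keep w} =
      {keep. \<forall>e\<in>vertex_star n v \<union> vertex_star n w. \<not> keep e}"
    by (auto simp: isolated_def)
  then have "measure_pmf.prob (percolation n p) {keep. isolated n keep v \<and> isolated n keep w} =
      (1 - p) ^ card (vertex_star n v \<union> vertex_star n w)"
    using prob_all_False[OF finite_permutahedron_edges p, of "vertex_star n v \<union> vertex_star n w" n]
      vertex_star_subset by simp
  also have "\<dots> \<le> (1 - p) ^ (2 * n - 1)"
    using p card_vertex_star_Un[OF assms] by (intro power_decreasing) auto
  finally show ?thesis .
qed

text \<open>No star of a vertex in \<open>U\<close> meets the star of \<open>v\<close>, so the event
  for \<open>U\<close> ignores the coins around \<open>v\<close>.\<close>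

lemma prob_isolated_indep:
  assumes "v \<in> permutahedron_verts n" "v \<notin> U" "U \<inter> neighbours n v = {}"
  shows "measure_pmf.prob (percolation n p) ({keep. isolated n keep v} \<inter> none_isolated n U) =
    (1 - p) ^ n * measure_pmf.prob (percolation n p) (none_isolated n U)"
proof -
  have "measure_pmf.prob (percolation n p)
      {keep. (\<forall>e\<in>vertex_star n v. \<not> keep e) \<and> (\<forall>u\<in>U. \<not> isolated n keep u)} =
    (1 - p) ^ card (vertex_star n v) * measure_pmf.prob (percolation n p) {keep. \<forall>u\<in>U. \<not> isolated n keep u}"
  proof (rule prob_coins_False[OF finite_permutahedron_edges p vertex_star_subset])
    fix f g :: "(nat \<Rightarrow> nat) set \<Rightarrow> bool"
    assume eq: "\<And>e. e \<notin> vertex_star n v \<Longrightarrow> f e = g e"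
    have "isolated n f u = isolated n g u" if "u \<in> U" for u
    proof -
      have "vertex_star n v \<inter> vertex_star n u = {}"
        using vertex_star_disjoint[of v u n] that assms by blast
      then show ?thesis
        using eq by (auto simp: isolated_def)
    qed
    then show "(\<forall>u\<in>U. \<not> isolated n f u) = (\<forall>u\<in>U. \<not> isolated n g u)"
      by simp
  qed
  then show ?thesis
    using card_vertex_star[OF assms(1)] by (simp add: none_isolated_def isolated_def Collect_conj_eq)
qed

lemma prob_none_isolated_insert:
  "measure_pmf.prob (percolation n p) (none_isolated n (insert v U)) =
   measure_pmf.prob (percolation n p) (none_isolated n U) -
   measure_pmf.prob (percolation n p) ({keep. isolated n keep v} \<inter> none_isolated n U)"
proof -
  have "none_isolated n (insert v U) =
      none_isolated n U - ({keep. isolated n keep v} \<inter> none_isolated n U)"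
    by (auto simp: none_isolated_def)
  then show ?thesis
    by (simp add: measure_pmf.finite_measure_Diff)
qed

lemma prob_none_isolated_independent:
  assumes "finite U" "U \<subseteq> permutahedron_verts n" "\<And>u. u \<in> U \<Longrightarrow> U \<inter> neighbours n u = {}"
  shows "measure_pmf.prob (percolation n p) (none_isolated n U) = (1 - (1 - p) ^ n) ^ card U"
  using assms
proof (induction U rule: finite_induct)
  case (insert v U)
  have "measure_pmf.prob (percolation n p) ({keep. isolated n keep v} \<inter> none_isolated n U) =
    (1 - p) ^ n * measure_pmf.prob (percolation n p) (none_isolated n U)"
    using insert.prems insert.hyps by (intro prob_isolated_indep) auto
  moreover have "measure_pmf.prob (percolation n p) (none_isolated n U) = (1 - (1 - p) ^ n) ^ card U"
    using insert.prems by (intro insert.IH) auto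
  ultimately show ?case
    using insert.hyps by (simp add: prob_none_isolated_insert algebra_simps)
qed (simp add: none_isolated_def)

text \<open>Dropping the neighbours of \<open>v\<close> from \<open>U\<close> gives exact
  independence. The price is a union bound over at most \<open>n\<close> neighbours \<open>w\<close>
  that might be isolated.\<close>

lemma prob_isolated_almost_indep:
  assumes v: "v \<in> permutahedron_verts n" and U: "v \<notin> U" "U \<subseteq> permutahedron_verts n"
  shows "\<bar>measure_pmf.prob (percolation n p) ({keep. isolated n keep v} \<inter> none_isolated n U) -
    (1 - p) ^ n * measure_pmf.prob (percolation n p) (none_isolated n U)\<bar> \<le> n * (1 - p) ^ (2 * n - 1)"
proof -
  let ?P = "measure_pmf.prob (percolation n p)"
  let ?q = "1 - p"
  let ?B = "{keep. isolated n keep v}"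
  define W where "W = U \<inter> neighbours n v"
  define U' where "U' = U - neighbours n v"
  have W: "finite W" "card W \<le> n" "W \<subseteq> permutahedron_verts n" "v \<notin> W"
    using card_neighbours_le[OF v] card_mono[of "neighbours n v" W] U by (auto simp: W_def)
  have q: "0 \<le> ?q" "?q \<le> 1"
    using p by auto
  have split: "none_isolated n U' \<subseteq> none_isolated n U \<union> (\<Union>w\<in>W. {keep. isolated n keep w})"
    by (auto simp: none_isolated_def W_def U'_def)
  have mono: "none_isolated n U \<subseteq> none_isolated n U'"
    by (auto simp: none_isolated_def U'_def)
  have indep: "?P (?B \<inter> none_isolated n U') = ?q ^ n * ?P (none_isolated n U')"
    using v U by (intro prob_isolated_indep) (auto simp: U'_def)
  have "?P (none_isolated n U') \<le> ?P (none_isolated n U) + ?P (\<Union>w\<in>W. {keep. isolated n keep w})"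
    by (intro order_trans[OF measure_pmf.finite_measure_mono[OF split]] measure_Un_le) auto
  also have "?P (\<Union>w\<in>W. {keep. isolated n keep w}) \<le> (\<Sum>w\<in>W. ?P {keep. isolated n keep w})"
    using W by (intro measure_pmf.finite_measure_subadditive_finite) auto
  also have "\<dots> = (\<Sum>w\<in>W. ?q ^ n)"
    using W prob_isolated by (intro sum.cong) auto
  also have "\<dots> \<le> n * ?q ^ n"
    using W q by (simp add: mult_right_mono)
  finally have 1: "?P (none_isolated n U') \<le> ?P (none_isolated n U) + n * ?q ^ n"
    by simp
  have "?P (?B \<inter> none_isolated n U) \<le> ?q ^ n * ?P (none_isolated n U')"
    unfolding indep[symmetric] using mono by (intro measure_pmf.finite_measure_mono) auto
  also have "\<dots> \<le> ?q ^ n * (?P (none_isolated n U) + n * ?q ^ n)"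
    using 1 q by (intro mult_left_mono) auto
  also have "\<dots> = ?q ^ n * ?P (none_isolated n U) + n * ?q ^ (2 * n)"
    by (simp add: distrib_left mult_2 power_add)
  also have "\<dots> \<le> ?q ^ n * ?P (none_isolated n U) + n * ?q ^ (2 * n - 1)"
    using q by (intro add_left_mono mult_left_mono power_decreasing) auto
  finally have upper: "?P (?B \<inter> none_isolated n U) \<le> ?q ^ n * ?P (none_isolated n U) + n * ?q ^ (2 * n - 1)" .
  have "?q ^ n * ?P (none_isolated n U) \<le> ?q ^ n * ?P (none_isolated n U')"
    using mono q by (intro mult_left_mono measure_pmf.finite_measure_mono) auto
  also have "\<dots> = ?P (?B \<inter> none_isolated n U')"
    by (rule indep[symmetric])
  \<comment> \<open>Here \<open>v\<close> and \<open>w\<close> are isolated together; they share an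
    edge, so each \<open>w\<close> costs \<open>?q ^ (2 * n - 1)\<close> rather than
    \<open>?q ^ (2 * n)\<close>.\<close>
  also have "\<dots> \<le> ?P ((?B \<inter> none_isolated n U) \<union> (\<Union>w\<in>W. {keep. isolated n keep v \<and> isolated n keep w}))"
    using split by (intro measure_pmf.finite_measure_mono) auto
  also have "\<dots> \<le> ?P (?B \<inter> none_isolated n U) + ?P (\<Union>w\<in>W. {keep. isolated n keep v \<and> isolated n keep w})"
    by (intro measure_Un_le) auto
  also have "?P (\<Union>w\<in>W. {keep. isolated n keep v \<and> isolated n keep w}) \<le>
      (\<Sum>w\<in>W. ?P {keep. isolated n keep v \<and> isolated n keep w})"
    using W by (intro measure_pmf.finite_measure_subadditive_finite) auto
  also have "\<dots> \<le> (\<Sum>w\<in>W. ?q ^ (2 * n - 1))"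
    using W v by (intro sum_mono prob_both_isolated) auto
  also have "\<dots> \<le> n * ?q ^ (2 * n - 1)"
    using W q by (simp add: mult_right_mono)
  finally show ?thesis
    using upper by (simp add: abs_le_iff)
qed

text \<open>Each new vertex adds one error of almost-independence, while the error accumulated so
  far is multiplied by \<open>1 - (1 - p) ^ n\<close>, which is at most 1.\<close>

lemma prob_none_isolated_approx:
  assumes "finite U" "U \<subseteq> permutahedron_verts n"
  shows "\<bar>measure_pmf.prob (percolation n p) (none_isolated n U) - (1 - (1 - p) ^ n) ^ card U\<bar> \<le>
    card U * (n * (1 - p) ^ (2 * n - 1))"
  using assms
proof (induction U rule: finite_induct)
  case (insert v U)
  let ?P = "measure_pmf.prob (percolation n p)"
  define q where "q = (1 - p) ^ n"
  define \<epsilon> where "\<epsilon> = n * (1 - p) ^ (2 * n - 1)"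
  define D where "D = ?P (none_isolated n U)"
  define B where "B = ?P ({keep. isolated n keep v} \<inter> none_isolated n U)"
  have q: "0 \<le> q" "q \<le> 1"
    using p by (auto simp: q_def power_le_one)
  have "\<bar>D - (1 - q) ^ card U\<bar> \<le> card U * \<epsilon>"
    unfolding D_def q_def \<epsilon>_def using insert.prems by (intro insert.IH) auto
  then have "\<bar>(1 - q) * (D - (1 - q) ^ card U)\<bar> \<le> 1 * (card U * \<epsilon>)"
    unfolding abs_mult using q by (intro mult_mono) auto
  moreover have "\<bar>B - q * D\<bar> \<le> \<epsilon>"
    unfolding B_def D_def q_def \<epsilon>_def
    using insert.prems insert.hyps by (intro prob_isolated_almost_indep) auto
  moreover have "?P (none_isolated n (insert v U)) - (1 - q) ^ card (insert v U) =
      (1 - q) * (D - (1 - q) ^ card U) - (B - q * D)"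
    using insert.hyps by (simp add: prob_none_isolated_insert B_def D_def algebra_simps)
  ultimately have "\<bar>?P (none_isolated n (insert v U)) - (1 - q) ^ card (insert v U)\<bar> \<le> card U * \<epsilon> + \<epsilon>"
    by linarith
  also have "\<dots> = card (insert v U) * \<epsilon>"
    using insert.hyps by (simp add: algebra_simps)
  finally show ?case
    unfolding q_def \<epsilon>_def .
qed (simp add: none_isolated_def)

lemma prob_connected_le_independent:
  assumes "1 \<le> n"
  shows "measure_pmf.prob (percolation n p) {keep. kept_connected n keep} \<le>
    exp (- (permutahedron_lambda n p / 2))"
proof -
  let ?V = "permutahedron_verts n"
  let ?q = "(1 - p) ^ n"
  have q: "0 \<le> ?q" "?q \<le> 1"
    using p by (auto simp: power_le_one)
  have "card ?V = card {v \<in> ?V. evenperm v} + card {v \<in> ?V. \<not> evenperm v}"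
    by (subst card_Un_disjoint[symmetric])
      (auto simp: finite_permutahedron_verts intro: arg_cong[where f = card])
  then have "card ?V \<le> 2 * card {v \<in> ?V. evenperm v = True} \<or>
      card ?V \<le> 2 * card {v \<in> ?V. evenperm v = False}"
    unfolding eq_True eq_False by linarith
  \<comment> \<open>The larger parity class contains at least half of the vertices; \<open>b\<close>
    records its parity.\<close>
  then obtain b where b: "card ?V \<le> 2 * card {v \<in> ?V. evenperm v = b}"
    by blast
  define U where "U = {v \<in> ?V. evenperm v = b}"
  have U: "finite U" "U \<subseteq> ?V"
    using finite_permutahedron_verts by (auto simp: U_def)
  have "measure_pmf.prob (percolation n p) {keep. kept_connected n keep} \<le>
      measure_pmf.prob (percolation n p) (none_isolated n U)"
    using kept_connected_no_isolated assms U
    by (intro measure_pmf.finite_measure_mono) (auto simp: none_isolated_def)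
  also have "\<dots> = (1 - ?q) ^ card U"
    using U neighbours_parity by (intro prob_none_isolated_independent) (auto simp: U_def)
  also have "\<dots> \<le> exp (- ?q) ^ card U"
    using q exp_ge_add_one_self[of "- ?q"] by (intro power_mono) auto
  also have "\<dots> = exp (- (card U * ?q))"
    by (simp add: exp_of_nat_mult[symmetric])
  also have "\<dots> \<le> exp (- (permutahedron_lambda n p / 2))"
  proof -
    have "real (card ?V) \<le> 2 * real (card U)"
      using b unfolding U_def by linarith
    then have "real (card ?V) * ?q \<le> 2 * real (card U) * ?q"
      using q by (intro mult_right_mono) auto
    then show ?thesis
      unfolding permutahedron_lambda_def card_permutahedron_verts of_nat_fact by simp
  qed
  finally show ?thesis .
qed

section \<open>Exceptional configurations\<close>

lemma prob_many_closed:
  assumes "F \<subseteq> permutahedron_edges n"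
  shows "measure_pmf.prob (percolation n p) {keep. m \<le> card (F \<inter> closed_edges n keep)} \<le>
    2 ^ card F * (1 - p) ^ m"
proof -
  have "F \<inter> closed_edges n keep = {e \<in> F. \<not> keep e}" for keep
    using assms by (auto simp: closed_edges_def)
  then show ?thesis
    using prob_many_False[OF finite_permutahedron_edges p assms] by simp
qed

text \<open>Two adjacent poor vertices force about \<open>3 * n / 2\<close> closed edges, the shared
  one counted once. The exponent must exceed \<open>n\<close>: the first \<open>n\<close> factors
  turn \<open>fact (n + 1)\<close> into \<lambda>, and the other \<open>n div 4\<close> must beat
  \<open>2 ^ (2 * n)\<close>.\<close>

lemma prob_poor_pair:
  assumes "8 \<le> n"
  shows "measure_pmf.prob (percolation n p) (poor_pair n) \<le>
    fact (n + 1) * (n * (2 ^ (2 * n) * (1 - p) ^ (n + n div 4)))"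
proof -
  let ?P = "measure_pmf.prob (percolation n p)"
  let ?r = "2 ^ (2 * n) * (1 - p) ^ (n + n div 4)"
  have q: "0 \<le> 1 - p" "1 - p \<le> 1"
    using p by auto
  have pair: "?P {keep. poor n keep v \<and> poor n keep w} \<le> ?r"
    if "v \<in> permutahedron_verts n" "w \<in> neighbours n v" for v w
  proof -
    have w: "w \<in> permutahedron_verts n" "v \<noteq> w"
      using neighbours_subset[OF that(1)] neighbours_parity[OF that] that(2) by auto
    let ?F = "vertex_star n v \<union> vertex_star n w"
    have F: "card ?F \<le> 2 * n"
      using card_Un_le[of "vertex_star n v" "vertex_star n w"] that(1) w by (simp add: card_vertex_star)
    have "n + n div 4 \<le> card (?F \<inter> closed_edges n keep)" if "poor n keep v" "poor n keep w" for keep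
    proof -
      let ?A = "vertex_star n v \<inter> closed_edges n keep" and ?B = "vertex_star n w \<inter> closed_edges n keep"
      have "card (?A \<inter> ?B) \<le> card {{v, w}}"
        using vertex_star_Int[OF w(2), of n] by (intro card_mono) auto
      moreover have "card ?A + card ?B = card (?A \<union> ?B) + card (?A \<inter> ?B)"
        using finite_vertex_star by (intro card_Un_Int) auto
      moreover have "?A \<union> ?B = ?F \<inter> closed_edges n keep"
        by auto
      ultimately show ?thesis
        using that assms unfolding poor_def by simp
    qed
    then have "?P {keep. poor n keep v \<and> poor n keep w} \<le>
        ?P {keep. n + n div 4 \<le> card (?F \<inter> closed_edges n keep)}"
      by (intro measure_pmf.finite_measure_mono) auto
    also have "\<dots> \<le> 2 ^ card ?F * (1 - p) ^ (n + n div 4)"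
      using vertex_star_subset by (intro prob_many_closed) auto
    also have "\<dots> \<le> ?r"
      using F q by (intro mult_right_mono power_increasing) auto
    finally show ?thesis .
  qed
  have "?P (\<Union>w\<in>neighbours n v. {keep. poor n keep v \<and> poor n keep w}) \<le> n * ?r"
    if v: "v \<in> permutahedron_verts n" for v
  proof -
    have "?P (\<Union>w\<in>neighbours n v. {keep. poor n keep v \<and> poor n keep w}) \<le>
        (\<Sum>w\<in>neighbours n v. ?P {keep. poor n keep v \<and> poor n keep w})"
      using card_neighbours_le[OF v] by (intro measure_pmf.finite_measure_subadditive_finite) auto
    also have "\<dots> \<le> card (neighbours n v) * ?r"
      using pair[OF v] by (rule sum_bounded_above)
    also have "\<dots> \<le> n * ?r"
      using card_neighbours_le[OF v] q by (intro mult_right_mono) auto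
    finally show ?thesis .
  qed
  note star = this
  have "?P (poor_pair n) \<le> (\<Sum>v\<in>permutahedron_verts n.
      ?P (\<Union>w\<in>neighbours n v. {keep. poor n keep v \<and> poor n keep w}))"
    unfolding poor_pair_def using finite_permutahedron_verts
    by (intro measure_pmf.finite_measure_subadditive_finite) auto
  also have "\<dots> \<le> card (permutahedron_verts n) * (n * ?r)"
    using star by (rule sum_bounded_above)
  finally show ?thesis
    unfolding card_permutahedron_verts of_nat_fact .
qed

text \<open>Union bound over \<open>x\<close>, \<open>a\<close> and \<open>b\<close>. The exponent
  \<open>m\<close> is left open, to be chosen quadratic in \<open>n\<close> so as to beat
  \<open>2 ^ (4 * n\<^sup>2)\<close>.\<close>

lemma prob_blocked_detour:
  assumes "384 * m \<le> n\<^sup>2"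
  shows "measure_pmf.prob (percolation n p) (blocked_detour n) \<le>
    fact (n + 1) * ((n + 1)\<^sup>2 * (2 ^ (4 * n\<^sup>2) * (1 - p) ^ m))"
proof -
  let ?P = "measure_pmf.prob (percolation n p)"
  let ?I = "permutahedron_verts n \<times> {..n} \<times> {..n}"
  let ?S = "\<lambda>(x, a, b). {keep. n\<^sup>2 \<le> 384 * card (detour_edges n x a b \<inter> closed_edges n keep)}"
  have "?P (?S (x, a, b)) \<le> 2 ^ (4 * n\<^sup>2) * (1 - p) ^ m" for x a b
  proof -
    have "m \<le> c" if "n\<^sup>2 \<le> 384 * c" for c
      using assms that by linarith
    then have "?P (?S (x, a, b)) \<le> ?P {keep. m \<le> card (detour_edges n x a b \<inter> closed_edges n keep)}"
      by (intro measure_pmf.finite_measure_mono) auto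
    also have "\<dots> \<le> 2 ^ card (detour_edges n x a b) * (1 - p) ^ m"
      by (intro prob_many_closed) (auto simp: detour_edges_def)
    also have "\<dots> \<le> 2 ^ (4 * n\<^sup>2) * (1 - p) ^ m"
      using card_detour_edges p by (intro mult_right_mono power_increasing) auto
    finally show ?thesis .
  qed
  then have one: "?P (?S i) \<le> 2 ^ (4 * n\<^sup>2) * (1 - p) ^ m" for i
    by (cases i) blast
  have "?P (blocked_detour n) \<le> (\<Sum>i\<in>?I. ?P (?S i))"
    unfolding blocked_detour_def using finite_permutahedron_verts
    by (intro measure_pmf.finite_measure_subadditive_finite) auto
  also have "\<dots> \<le> card ?I * (2 ^ (4 * n\<^sup>2) * (1 - p) ^ m)"
    using one by (rule sum_bounded_above)
  finally show ?thesis
    by (simp add: card_permutahedron_verts card_cartesian_product power2_eq_square algebra_simps)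
qed

text \<open>Connectedness excludes isolated vertices, and absence of isolated vertices gives
  connectedness outside the two exceptional events.\<close>

lemma prob_connected_bounds:
  assumes "72 \<le> n"
  shows "\<bar>measure_pmf.prob (percolation n p) {keep. kept_connected n keep} -
      measure_pmf.prob (percolation n p) (none_isolated n (permutahedron_verts n))\<bar> \<le>
    measure_pmf.prob (percolation n p) (poor_pair n) + measure_pmf.prob (percolation n p) (blocked_detour n)"
proof -
  let ?P = "measure_pmf.prob (percolation n p)"
  let ?N = "none_isolated n (permutahedron_verts n)"
  have "?P {keep. kept_connected n keep} \<le> ?P ?N"
    using kept_connected_no_isolated assms
    by (intro measure_pmf.finite_measure_mono) (auto simp: none_isolated_def)
  moreover have "?P ?N \<le> ?P ({keep. kept_connected n keep} \<union> (poor_pair n \<union> blocked_detour n))"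
  proof (intro measure_pmf.finite_measure_mono subsetI)
    fix keep assume keep: "keep \<in> ?N"
    show "keep \<in> {keep. kept_connected n keep} \<union> (poor_pair n \<union> blocked_detour n)"
    proof (rule ccontr)
      assume neg: "keep \<notin> {keep. kept_connected n keep} \<union> (poor_pair n \<union> blocked_detour n)"
      have "kept_connected n keep"
      proof (rule kept_connectedI[OF assms])
        show "384 * card (detour_edges n x a b \<inter> closed_edges n keep) < n\<^sup>2"
          if "x \<in> permutahedron_verts n" "a \<le> n" "b \<le> n" for x a b
          using neg that unfolding blocked_detour_def by (auto simp: not_le)
      qed (use keep neg in \<open>auto simp: none_isolated_def poor_pair_def\<close>)
      with neg show False
        by simp
    qed
  qed simp
  moreover have "?P ({keep. kept_connected n keep} \<union> (poor_pair n \<union> blocked_detour n)) \<le>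
      ?P {keep. kept_connected n keep} + (?P (poor_pair n) + ?P (blocked_detour n))"
    by (intro order_trans[OF measure_Un_le] add_left_mono
        measure_Un_le) auto
  ultimately show ?thesis
    by linarith
qed

end

section \<open>Asymptotics\<close>

lemma power_le_half_power:
  fixes q :: real
  assumes "0 \<le> q" "q \<le> (1 / 2) ^ K" "M \<le> K * j"
  shows "q ^ j \<le> (1 / 2) ^ M"
proof -
  have "q ^ j \<le> ((1 / 2) ^ K) ^ j"
    using assms by (intro power_mono)
  also have "\<dots> = (1 / 2) ^ (K * j)"
    by (simp only: power_mult)
  also have "\<dots> \<le> (1 / 2) ^ M"
    using assms by (intro power_decreasing) auto
  finally show ?thesis .
qed

text \<open>In each of the three error terms \<open>q ^ n\<close> is split off and merged with the
  factorial into \<lambda>, which is at most \<open>L\<close>; the remaining power of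
  \<open>q\<close> decays. The factor 4 is the sum of the weights 2, 1 and 1.\<close>

lemma prob_connected_approx:
  assumes p: "p \<in> {0..1}" and small: "1 - p \<le> (1 / 2) ^ 8000" and n: "800 \<le> n"
    and L: "permutahedron_lambda n p \<le> L"
  shows "\<bar>measure_pmf.prob (percolation n p) {keep. kept_connected n keep} -
    (1 - (1 - p) ^ n) ^ fact (n + 1)\<bar> \<le> 4 * L * (real n + 1)\<^sup>2 * (1 / 2) ^ n"
proof -
  let ?P = "measure_pmf.prob (percolation n p)"
  define q where "q = 1 - p"
  define lam where "lam = permutahedron_lambda n p"
  define N where "N = (fact (n + 1) :: real)"
  define h where "h = (1 / 2 :: real) ^ n"
  have q: "0 \<le> q" "q \<le> 1"
    using p by (auto simp: q_def)
  have lam: "lam = N * q ^ n" "0 \<le> lam" "lam \<le> L"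
    using L q by (simp_all add: lam_def permutahedron_lambda_def N_def q_def)
  have h: "0 \<le> h"
    by (simp add: h_def)
  have pow: "q ^ j \<le> (1 / 2) ^ M" if "M \<le> 8000 * j" for j M
    using q(1) small that unfolding q_def by (rule power_le_half_power)
  have cancel: "2 ^ a * (1 / 2) ^ (a + k) = (1 / 2 :: real) ^ k" for a k
    by (simp add: power_add power_one_over)
  have 1: "N * (n * q ^ (2 * n - 1)) \<le> L * ((real n + 1)\<^sup>2 * (2 * h))"
  proof -
    have "N * (n * q ^ (2 * n - 1)) = lam * (n * q ^ (n - 1))"
    proof -
      have "2 * n - 1 = n + (n - 1)"
        using n by simp
      then show ?thesis
        by (simp add: lam power_add)
    qed
    also have "q ^ (n - 1) \<le> h"
      unfolding h_def using n by (intro pow) simp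
    also have "lam * (n * h) \<le> L * ((real n + 1)\<^sup>2 * (2 * h))"
    proof (intro mult_mono)
      show "real n \<le> (real n + 1)\<^sup>2"
        by (simp add: power2_eq_square algebra_simps)
    qed (use lam h in auto)
    finally show ?thesis
      using lam by (simp add: mult_left_mono)
  qed
  have 2: "N * (n * (2 ^ (2 * n) * q ^ (n + n div 4))) \<le> L * ((real n + 1)\<^sup>2 * h)"
  proof -
    have "N * (n * (2 ^ (2 * n) * q ^ (n + n div 4))) = lam * (n * (2 ^ (2 * n) * q ^ (n div 4)))"
      by (simp add: lam power_add)
    also have "\<dots> \<le> L * ((real n + 1)\<^sup>2 * h)"
    proof (intro mult_mono)
      have "2 ^ (2 * n) * q ^ (n div 4) \<le> 2 ^ (2 * n) * (1 / 2) ^ (2 * n + n)"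
        using n by (intro mult_left_mono pow) auto
      also have "\<dots> = h"
        unfolding h_def by (rule cancel)
      finally show "2 ^ (2 * n) * q ^ (n div 4) \<le> h" .
      show "real n \<le> (real n + 1)\<^sup>2"
        by (simp add: power2_eq_square algebra_simps)
    qed (use lam h q in auto)
    finally show ?thesis .
  qed
  have 3: "N * ((n + 1)\<^sup>2 * (2 ^ (4 * n\<^sup>2) * q ^ (n + (n\<^sup>2 div 800 + 1)))) \<le> L * ((real n + 1)\<^sup>2 * h)"
  proof -
    have "N * ((n + 1)\<^sup>2 * (2 ^ (4 * n\<^sup>2) * q ^ (n + (n\<^sup>2 div 800 + 1)))) =
        lam * ((real n + 1)\<^sup>2 * (2 ^ (4 * n\<^sup>2) * q ^ (n\<^sup>2 div 800 + 1)))"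
      unfolding power_add[of q n] lam by (simp add: add.commute)
    also have "\<dots> \<le> L * ((real n + 1)\<^sup>2 * h)"
    proof (intro mult_mono)
      \<comment> \<open>This needs
        \<open>5 * n\<^sup>2 \<le> 8000 * (n\<^sup>2 div 800 + 1)\<close>; the \<open>+ 1\<close>
        makes up for rounding in \<open>div\<close>.\<close>
      have "2 ^ (4 * n\<^sup>2) * q ^ (n\<^sup>2 div 800 + 1) \<le> 2 ^ (4 * n\<^sup>2) * (1 / 2) ^ (4 * n\<^sup>2 + n\<^sup>2)"
        by (intro mult_left_mono pow) auto
      also have "\<dots> = (1 / 2) ^ n\<^sup>2"
        by (rule cancel)
      also have "\<dots> \<le> h"
        unfolding h_def using n by (intro power_decreasing) (auto simp: power2_eq_square)
      finally show "2 ^ (4 * n\<^sup>2) * q ^ (n\<^sup>2 div 800 + 1) \<le> h" .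
    qed (use lam h q in auto)
    finally show ?thesis .
  qed
  have m: "384 * (n + (n\<^sup>2 div 800 + 1)) \<le> n\<^sup>2"
  proof -
    \<comment> \<open>Each of \<open>n\<close> and \<open>d\<close> is at most
      \<open>y / 800\<close>, so together they use \<open>768 / 800\<close> of \<open>y\<close>; the
      rest covers the final 384.\<close>
    have le: "384 * (n + (d + 1)) \<le> y" if "800 * n \<le> y" "800 * d \<le> y" for d y
      using that n by simp
    show ?thesis
    proof (rule le)
      show "800 * n \<le> n\<^sup>2"
        using n by (simp add: power2_eq_square)
      show "800 * (n\<^sup>2 div 800) \<le> n\<^sup>2"
        by (rule times_div_less_eq_dividend)
    qed
  qed
  have n': "72 \<le> n" "8 \<le> n"
    using n by auto
  have "\<bar>?P {keep. kept_connected n keep} - ?P (none_isolated n (permutahedron_verts n))\<bar> \<le>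
      ?P (poor_pair n) + ?P (blocked_detour n)"
    by (rule prob_connected_bounds[OF p n'(1)])
  moreover have "?P (poor_pair n) \<le> N * (n * (2 ^ (2 * n) * q ^ (n + n div 4)))"
    using prob_poor_pair[OF p n'(2)] unfolding N_def q_def .
  moreover have "?P (blocked_detour n) \<le> N * ((n + 1)\<^sup>2 * (2 ^ (4 * n\<^sup>2) * q ^ (n + (n\<^sup>2 div 800 + 1))))"
    using prob_blocked_detour[OF p m] unfolding N_def q_def .
  moreover have "\<bar>?P (none_isolated n (permutahedron_verts n)) - (1 - q ^ n) ^ fact (n + 1)\<bar> \<le>
      N * (n * q ^ (2 * n - 1))"
    using prob_none_isolated_approx[OF p finite_permutahedron_verts subset_refl, of n]
    unfolding card_permutahedron_verts N_def q_def of_nat_fact .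
  ultimately have "\<bar>?P {keep. kept_connected n keep} - (1 - q ^ n) ^ fact (n + 1)\<bar> \<le>
      L * ((real n + 1)\<^sup>2 * (2 * h)) + L * ((real n + 1)\<^sup>2 * h) + L * ((real n + 1)\<^sup>2 * h)"
    using 1 2 3 by linarith
  also have "\<dots> = 4 * L * (real n + 1)\<^sup>2 * h"
    by (simp add: algebra_simps)
  finally show ?thesis
    unfolding q_def h_def .
qed

text \<open>If \<open>1 - p n\<close> exceeded \<epsilon>, then \<lambda> would be at least
  \<open>fact n * \<epsilon> ^ n\<close>, which outgrows \<open>L\<close>; this growth is read off
  from the terms of the exponential series.\<close>

lemma lambda_bounded_imp_small:
  fixes p :: "nat \<Rightarrow> real"
  assumes p: "\<And>n. p n \<in> {0..1}" and L: "\<forall>\<^sub>F n in sequentially. permutahedron_lambda n (p n) \<le> L"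
    and \<epsilon>: "0 < \<epsilon>"
  shows "\<forall>\<^sub>F n in sequentially. 1 - p n \<le> \<epsilon>"
proof -
  have "(\<lambda>n. inverse (fact n) * (1 / \<epsilon>) ^ n) \<longlonglongrightarrow> 0"
    using summable_LIMSEQ_zero[OF summable_exp[of "1 / \<epsilon>"]] .
  then have "(\<lambda>n. L * (inverse (fact n) * (1 / \<epsilon>) ^ n)) \<longlonglongrightarrow> L * 0"
    by (intro tendsto_intros)
  then have "\<forall>\<^sub>F n in sequentially. L * (inverse (fact n) * (1 / \<epsilon>) ^ n) < 1"
    by (rule order_tendstoD(2)) simp
  then show ?thesis
    using L
  proof eventually_elim
    case (elim n)
    show ?case
    proof (rule ccontr)
      assume "\<not> 1 - p n \<le> \<epsilon>"
      then have "\<epsilon> ^ n \<le> (1 - p n) ^ n"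
        using \<epsilon> by (intro power_mono) auto
      then have "fact n * \<epsilon> ^ n \<le> fact (n + 1) * (1 - p n) ^ n"
        using \<epsilon> by (intro mult_mono fact_mono) auto
      with elim(2) have "fact n * \<epsilon> ^ n \<le> L"
        unfolding permutahedron_lambda_def by linarith
      with elim(1) show False
        using \<epsilon> by (simp add: field_simps power_divide)
    qed
  qed
qed

text \<open>Squeeze by \<open>- a / (1 - a) \<le> ln (1 - a) \<le> - a\<close>, both sides being
  instances of \<open>1 + x \<le> exp x\<close>.\<close>

lemma tendsto_power_exp:
  fixes a :: "nat \<Rightarrow> real" and N :: "nat \<Rightarrow> nat"
  assumes a: "\<And>n. 0 \<le> a n" "a \<longlonglongrightarrow> 0" and lim: "(\<lambda>n. real (N n) * a n) \<longlonglongrightarrow> c"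
  shows "(\<lambda>n. (1 - a n) ^ N n) \<longlonglongrightarrow> exp (- c)"
proof (rule tendsto_sandwich)
  have lt: "\<forall>\<^sub>F n in sequentially. a n < 1"
    using a(2) by (rule order_tendstoD(2)) simp
  show "\<forall>\<^sub>F n in sequentially. exp (- (real (N n) * a n / (1 - a n))) \<le> (1 - a n) ^ N n"
    using lt
  proof eventually_elim
    case (elim n)
    have "1 / (1 - a n) = 1 + a n / (1 - a n)"
      using elim by (simp add: field_simps)
    also have "\<dots> \<le> exp (a n / (1 - a n))"
      by (rule exp_ge_add_one_self)
    finally have "exp (- (a n / (1 - a n))) \<le> 1 - a n"
      using elim by (simp add: exp_minus field_simps)
    then have "exp (- (a n / (1 - a n))) ^ N n \<le> (1 - a n) ^ N n"
      by (intro power_mono) auto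
    then show ?case
      by (simp add: exp_of_nat_mult[symmetric])
  qed
  show "\<forall>\<^sub>F n in sequentially. (1 - a n) ^ N n \<le> exp (- (real (N n) * a n))"
    using lt
  proof eventually_elim
    case (elim n)
    have "(1 - a n) ^ N n \<le> exp (- a n) ^ N n"
      using elim exp_ge_add_one_self[of "- a n"] by (intro power_mono) auto
    then show ?case
      by (simp add: exp_of_nat_mult[symmetric])
  qed
  show "(\<lambda>n. exp (- (real (N n) * a n))) \<longlonglongrightarrow> exp (- c)"
    by (intro tendsto_intros lim)
  have "(\<lambda>n. exp (- (real (N n) * a n / (1 - a n)))) \<longlonglongrightarrow> exp (- (c / (1 - 0)))"
    by (intro tendsto_intros lim a(2)) simp
  then show "(\<lambda>n. exp (- (real (N n) * a n / (1 - a n)))) \<longlonglongrightarrow> exp (- c)"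
    by simp
qed

lemma tendsto_prob_connected:
  fixes p :: "nat \<Rightarrow> real"
  assumes p: "\<And>n. p n \<in> {0..1}" and lim: "(\<lambda>n. permutahedron_lambda n (p n)) \<longlonglongrightarrow> c"
  shows "(\<lambda>n. measure_pmf.prob (percolation n (p n)) {keep. kept_connected n keep}) \<longlonglongrightarrow> exp (- c)"
proof -
  define L where "L = c + 1"
  let ?P = "\<lambda>n. measure_pmf.prob (percolation n (p n)) {keep. kept_connected n keep}"
  let ?Q = "\<lambda>n. (1 - (1 - p n) ^ n) ^ fact (n + 1)"
  have L: "\<forall>\<^sub>F n in sequentially. permutahedron_lambda n (p n) \<le> L"
    using order_tendstoD(2)[OF lim, of L] by (auto simp: L_def elim: eventually_mono)
  have half: "(0 :: real) < (1 / 2) ^ 8000"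
    by (rule zero_less_power) simp
  have "\<forall>\<^sub>F n in sequentially. norm (?P n - ?Q n) \<le> 4 * L * (real n + 1)\<^sup>2 * (1 / 2) ^ n"
    using L lambda_bounded_imp_small[OF p L half] eventually_ge_at_top[of 800]
  proof eventually_elim
    case (elim n)
    then show ?case
      unfolding real_norm_def by (intro prob_connected_approx p)
  qed
  moreover have "(\<lambda>n. 4 * L * (real n + 1)\<^sup>2 * (1 / 2) ^ n) \<longlonglongrightarrow> 0"
    by real_asymp
  ultimately have diff: "(\<lambda>n. ?P n - ?Q n) \<longlonglongrightarrow> 0"
    by (rule Lim_null_comparison)
  have "?Q \<longlonglongrightarrow> exp (- c)"
  proof (rule tendsto_power_exp)
    show "0 \<le> (1 - p n) ^ n" for n
      using p[of n] by simp
    \<comment> \<open>Dividing the convergent \<lambda> by \<open>fact (n + 1)\<close> leaves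
      \<open>(1 - p n) ^ n\<close>, which therefore tends to 0.\<close>
    have "(\<lambda>n. permutahedron_lambda n (p n) * inverse (fact (n + 1))) \<longlonglongrightarrow> c * 0"
    proof (rule tendsto_mult[OF lim])
      have "(\<lambda>n. inverse (fact n) * 1 ^ n :: real) \<longlonglongrightarrow> 0"
        using summable_LIMSEQ_zero[OF summable_exp[of "1 :: real"]] .
      then have "(\<lambda>n. inverse (fact n) :: real) \<longlonglongrightarrow> 0"
        by simp
      then show "(\<lambda>n. inverse (fact (n + 1)) :: real) \<longlonglongrightarrow> 0"
        by (rule LIMSEQ_ignore_initial_segment)
    qed
    then show "(\<lambda>n. (1 - p n) ^ n) \<longlonglongrightarrow> 0"
      unfolding permutahedron_lambda_def by (simp add: field_simps del: fact_Suc)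
    show "(\<lambda>n. real (fact (n + 1)) * (1 - p n) ^ n) \<longlonglongrightarrow> c"
      using lim unfolding permutahedron_lambda_def of_nat_fact .
  qed
  with diff have "(\<lambda>n. (?P n - ?Q n) + ?Q n) \<longlonglongrightarrow> 0 + exp (- c)"
    by (rule tendsto_add)
  then show ?thesis
    by simp
qed

theorem theorem1p7:
  fixes p :: "nat \<Rightarrow> real"
  assumes "\<And>n. p n \<in> {0..1}"
  shows "(filterlim (\<lambda>n. permutahedron_lambda n (p n)) at_top sequentially \<longrightarrow>
            (\<lambda>n. measure_pmf.prob (random_permutahedron n (p n))
                   {G. Digraph_Component.connected (with_proj G)}) \<longlonglongrightarrow> 0) \<and>
         (\<forall>c\<ge>0. (\<lambda>n. permutahedron_lambda n (p n)) \<longlonglongrightarrow> c \<longrightarrow>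
            (\<lambda>n. measure_pmf.prob (random_permutahedron n (p n))
                   {G. Digraph_Component.connected (with_proj G)}) \<longlonglongrightarrow> exp (- c))"
  unfolding prob_connected_eq
proof (intro conjI impI allI)
  assume lim: "filterlim (\<lambda>n. permutahedron_lambda n (p n)) at_top sequentially"
  show "(\<lambda>n. measure_pmf.prob (percolation n (p n)) {keep. kept_connected n keep}) \<longlonglongrightarrow> 0"
  proof (rule tendsto_sandwich[where f = "\<lambda>_. 0"])
    show "\<forall>\<^sub>F n in sequentially. measure_pmf.prob (percolation n (p n)) {keep. kept_connected n keep} \<le>
        exp (- (permutahedron_lambda n (p n) / 2))"
      using eventually_ge_at_top[of 1]
      by eventually_elim (rule prob_connected_le_independent[OF assms])
    have "filterlim (\<lambda>n. (1 / 2) * permutahedron_lambda n (p n)) at_top sequentially"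
      by (rule filterlim_tendsto_pos_mult_at_top[OF tendsto_const _ lim]) simp
    then have "filterlim (\<lambda>n. - (permutahedron_lambda n (p n) / 2)) at_bot sequentially"
      by (simp add: filterlim_uminus_at_top)
    then show "(\<lambda>n. exp (- (permutahedron_lambda n (p n) / 2))) \<longlonglongrightarrow> 0"
      by (rule filterlim_compose[OF exp_at_bot])
  qed auto
qed (rule tendsto_prob_connected[OF assms])

end
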